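(* Fix a constant $\bar\rho<1/2$. Let $Q\in\mathbb{Q}^{n\times n}$ and $q\in\mathbb{Q}^n$, with $I-Q$ and $I+Q$ nonsingular, be written as $Q=\bar Q/d_Q$, $q=\bar q/d_q$ with $\bar Q\in\mathbb{Z}^{n\times n}$, $\bar q\in\mathbb{Z}^n$, $d_Q,d_q\in\mathbb{Z}_{>0}$, and let $\bar L=\max\{d_q,d_Q,\|\bar q\|_\infty,\|\bar Q\|_{\max}\}$. Let $R=(I-Q)(I+Q)^{-1}$ be the Cayley transform of $Q$ and consider the absolute value equation $$A_{\rm c}x-|x|=b_{\rm c},\qquad A_{\rm c}=(I+Q)(I-Q)^{-1},\quad b_{\rm c}=-2(I-Q)^{-1}q,$$ equivalent to the linear complementarity problem $v=Qu+q$, $u,v\ge0$, $u^Tv=0$. If $\rho(|R|)\le\bar\rho<1/2$, then the sign-flip algorithm (without preconditioning) equipped with the randomized $1$-flip rule, applied to $A_{\rm c}x-|x|=b_{\rm c}$, terminates at the unique solution from any initial point, with an expected iteration complexity of $\mathcal{O}\bigl(n^4\log(n\bar L)\bigr)$. Furthermore, under the stronger condition $\|R\|_1\le\bar\rho<1/2$, the sign-flip algorithm equipped with either the Gauss--Southwell or the steepest single-flip rule terminates at the unique solution from any initial point within $\mathcal{O}\bigl(n^3\log(n\bar L)\bigr)$ iterations.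
   Context: $|X|$ and $|x|$ are entrywise; $\rho(\cdot)$ is the spectral radius; $\|\cdot\|_1$ for matrices is the maximum absolute column sum; $\|\cdot\|_\infty$ for vectors is the maximum absolute entry; $\|X\|_{\max}=\max_{i,j}|X_{ij}|$. The equivalence between the absolute value equation and the linear complementarity problem is through $u=(|x|+x)/2$, $v=(|x|-x)/2$. Sign-flip algorithm for $A_{\rm c}x-|x|=b_{\rm c}$: initialize $z\in\{-1,1\}^n$, $Z=\operatorname{Diag}(z)$; compute $x=(A_{\rm c}-Z)^{-1}b_{\rm c}$ and the mismatch set $\mathcal{V}_z=\{i\in\{1,\dots,n\}: z_ix_i<0\}$. While $\mathcal{V}_z\neq\emptyset$: select a nonempty subset $S\subseteq\mathcal{V}_z$ by some rule; replace $z_i$ by $-z_i$ for $i\in S$; recompute $Z$, $x$ and $\mathcal{V}_z$. When $\mathcal{V}_z=\emptyset$, return $x$. One pass through the while loop is one iteration; the initial point is the initial sign vector $z$. ($A_{\rm c}-Z$ is nonsingular for all $z\in\{-1,1\}^n$ under the stated conditions.) Selection rules, with $H=(A_{\rm c}-Z)^{-1}$, $x=Hb_{\rm c}$, $y=H^Tz$: - Randomized $1$-flip rule: $S=\{k\}$ with $k$ uniformly random in $\mathcal{V}_z$ (given the current $z$, independently of the past). - Gauss--Southwell single-flip rule: $S=\{k^*\}$ with $k^*\in\arg\max_{i\in\mathcal{V}_z}|x_i|$. - Steepest single-flip rule: $S=\{k^*\}$ with $k^*\in\arg\max_{i\in\mathcal{V}_z}\frac{-2z_ix_i(1+y_i)}{1+2z_iH_{ii}}$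 (the change of $z^T(A_{\rm c}-Z)^{-1}b_{\rm c}$ upon flipping coordinate $i$). The constants implied by $\mathcal{O}$ depend only on the fixed constant $\bar\rho$. *)

theory Defs
  imports
    "HOL-Probability.Probability"
    "Jordan_Normal_Form.Spectral_Radius"
    "Jordan_Normal_Form.Gauss_Jordan_Elimination"
begin

hide_const (open) Finite_Cartesian_Product.vec
hide_type (open) Finite_Cartesian_Product.vec
unbundle no vec_syntax

notation vec_index (infixl "$" 100)

abbreviation mat_inv :: "'a::field mat \<Rightarrow> 'a mat"
  where "mat_inv M \<equiv> the (mat_inverse M)"

abbreviation mat_abs :: "real mat \<Rightarrow> real mat"
  where "mat_abs \<equiv> map_mat abs"

abbreviation vec_abs :: "real vec \<Rightarrow> real vec"
  where "vec_abs \<equiv> map_vec abs"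

definition norm_one_mat :: "real mat \<Rightarrow> real"
  where "norm_one_mat M = Max ((\<lambda>j. \<Sum>i<dim_row M. \<bar>M $$ (i, j)\<bar>) ` {..<dim_col M})"

definition norm_max_mat :: "'a::linordered_idom mat \<Rightarrow> 'a"
  where "norm_max_mat M = Max ((\<lambda>ij. \<bar>M $$ ij\<bar>) ` ({..<dim_row M} \<times> {..<dim_col M}))"

definition norm_inf_vec :: "'a::linordered_idom vec \<Rightarrow> 'a"
  where "norm_inf_vec v = Max ((\<lambda>i. \<bar>v $ i\<bar>) ` {..<dim_vec v})"

definition real_spectral_radius :: "real mat \<Rightarrow> real"
  where "real_spectral_radius M = spectral_radius (map_mat complex_of_real M)"

definition cayley :: "real mat \<Rightarrow> real mat"
  where "cayley Q = (1\<^sub>m (dim_row Q) - Q) * mat_inv (1\<^sub>m (dim_row Q) + Q)"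

definition ave_mat :: "real mat \<Rightarrow> real mat"
  where "ave_mat Q = (1\<^sub>m (dim_row Q) + Q) * mat_inv (1\<^sub>m (dim_row Q) - Q)"

definition ave_rhs :: "real mat \<Rightarrow> real vec \<Rightarrow> real vec"
  where "ave_rhs Q q = (-2) \<cdot>\<^sub>v (mat_inv (1\<^sub>m (dim_row Q) - Q) *\<^sub>v q)"

definition ave_solutions :: "real mat \<Rightarrow> real vec \<Rightarrow> real vec set"
  where "ave_solutions A b =
    {x \<in> carrier_vec (dim_col A). A *\<^sub>v x - vec_abs x = b}"

definition lcp_solutions :: "real mat \<Rightarrow> real vec \<Rightarrow> (real vec \<times> real vec) set"
  where "lcp_solutions Q q =
    {(u, v). u \<in> carrier_vec (dim_col Q) \<and> v \<in> carrier_vec (dim_row Q) \<and>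
       v = Q *\<^sub>v u + q \<and>
       (\<forall>i<dim_vec u. 0 \<le> u $ i) \<and> (\<forall>i<dim_vec v. 0 \<le> v $ i) \<and> u \<bullet> v = 0}"

definition ave_to_lcp :: "real vec \<Rightarrow> real vec \<times> real vec"
  where "ave_to_lcp x = ((1/2) \<cdot>\<^sub>v (vec_abs x + x), (1/2) \<cdot>\<^sub>v (vec_abs x - x))"

definition sign_vecs :: "nat \<Rightarrow> real vec set"
  where "sign_vecs n = {z \<in> carrier_vec n. \<forall>i<n. z $ i \<in> {-1, 1}}"

definition diag_of :: "real vec \<Rightarrow> real mat"
  where "diag_of z = mat_diag (dim_vec z) (\<lambda>i. z $ i)"

definition mismatch :: "real vec \<Rightarrow> real vec \<Rightarrow> nat set"
  where "mismatch z x = {i. i < dim_vec z \<and> z $ i * x $ i < 0}"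

definition flip :: "nat set \<Rightarrow> real vec \<Rightarrow> real vec"
  where "flip S z = vec (dim_vec z) (\<lambda>i. if i \<in> S then - z $ i else z $ i)"

text \<open>
  A selection rule states which flip sets \<open>S\<close> are admissible (all tie-breaking choices are allowed),
  given \<open>H\<close>, the inverse of \<open>A - Z\<close>, the point \<open>x = H b\<close> and the sign vector \<open>z\<close>.
\<close>

type_synonym flip_rule = "real mat \<Rightarrow> real vec \<Rightarrow> real vec \<Rightarrow> nat set \<Rightarrow> bool"

definition gauss_southwell_rule :: flip_rule
  where "gauss_southwell_rule H x z S \<longleftrightarrow>
    (\<exists>k. S = {k} \<and> is_arg_max (\<lambda>i. \<bar>x $ i\<bar>) (\<lambda>i. i \<in> mismatch z x) k)"

definition steepest_rule :: flip_rule
  where "steepest_rule H x z S \<longleftrightarrow>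
    (let y = transpose_mat H *\<^sub>v z in
     \<exists>k. S = {k} \<and>
       is_arg_max (\<lambda>i. (- 2 * z $ i * x $ i * (1 + y $ i)) / (1 + 2 * z $ i * H $$ (i, i)))
         (\<lambda>i. i \<in> mismatch z x) k)"

text \<open>One pass through the loop. There is no transition from \<open>z\<close> if \<open>A - Z\<close> is singular.\<close>

inductive sign_flip_step :: "flip_rule \<Rightarrow> real mat \<Rightarrow> real vec \<Rightarrow> real vec \<Rightarrow> real vec \<Rightarrow> bool"
  for rule A b
  where
    "\<lbrakk>mat_inverse (A - diag_of z) = Some H; x = H *\<^sub>v b;
      S \<noteq> {}; S \<subseteq> mismatch z x; rule H x z S\<rbrakk>
     \<Longrightarrow> sign_flip_step rule A b z (flip S z)"

definition sign_flip_returns :: "real mat \<Rightarrow> real vec \<Rightarrow> real vec \<Rightarrow> real vec \<Rightarrow> bool"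
  where "sign_flip_returns A b z x \<longleftrightarrow>
    (\<exists>H. mat_inverse (A - diag_of z) = Some H \<and> x = H *\<^sub>v b \<and> mismatch z x = {})"

text \<open>
  Every execution from \<open>z\<close> makes at most \<open>N\<close> passes through the loop, never gets stuck
  (in particular never meets a singular \<open>A - Z\<close>), and hence ends by returning \<open>x\<close>.
\<close>

definition sign_flip_terminates ::
    "flip_rule \<Rightarrow> real mat \<Rightarrow> real vec \<Rightarrow> real vec \<Rightarrow> real vec \<Rightarrow> real \<Rightarrow> bool"
  where "sign_flip_terminates rule A b z x N \<longleftrightarrow>
    (\<forall>k z'. (sign_flip_step rule A b ^^ k) z z' \<longrightarrow>
       real k \<le> N \<and>
       (sign_flip_returns A b z' x \<or> (\<exists>z''. sign_flip_step rule A b z' z'')))"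

text \<open>
  The algorithm with the randomized 1-flip rule, as a probabilistic program returning the final point
  together with the number of iterations. The mass missing from the subprobability distribution is
  the probability that the loop runs forever or meets a singular \<open>A - Z\<close>.
\<close>

partial_function (spmf) randomized_sign_flip ::
    "real mat \<Rightarrow> real vec \<Rightarrow> real vec \<Rightarrow> (real vec \<times> nat) spmf"
  where
    "randomized_sign_flip A b z =
      (case mat_inverse (A - diag_of z) of
         None \<Rightarrow> return_pmf None
       | Some H \<Rightarrow>
           let x = H *\<^sub>v b in
           if mismatch z x = {} then return_spmf (x, 0)
           else bind_spmf (spmf_of_set (mismatch z x)) (\<lambda>k.
                  map_spmf (\<lambda>(x', m). (x', Suc m))
                    (randomized_sign_flip A b (flip {k} z))))"

definition randomized_expected_iterations :: "real mat \<Rightarrow> real vec \<Rightarrow> real vec \<Rightarrow> ennreal"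
  where "randomized_expected_iterations A b z =
    (\<integral>\<^sup>+ (x, m). of_nat m \<partial>measure_spmf (randomized_sign_flip A b z))"

end

theory Submission
  imports Defs
begin

text \<open>
  Choose weights \<open>w \<ge> 1\<close> with \<open>|R|\<^sup>T w \<le> r w\<close> for some \<open>r < 1/2\<close>: \<open>w = 1\<close> under the column sum
  condition, a perturbed Perron vector under the spectral one. In the weighted 1-norm \<open>R\<close> is a
  contraction with factor \<open>r\<close>, and flipping a mismatched \<open>k\<close> raises the potential
  \<open>w\<^sup>T Z x\<close> by at least a constant times \<open>w\<^sub>k |x\<^sub>k|\<close>, while the distance \<open>g\<close> of the potential
  from its maximum is at most \<open>4 \<Sum>\<^sub>k w\<^sub>k |x\<^sub>k|\<close> over the mismatched \<open>k\<close>. So one step multiplies \<open>g\<close> by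
  \<open>1 - \<Omega>(1/n)\<close>, in expectation or surely depending on the rule, and \<open>1 + ln (g / g\<^sub>m\<^sub>i\<^sub>n)\<close> drops
  by \<open>\<Omega>(1/n)\<close>. Cramer's rule for integer systems bounds the nonzero \<open>|x\<^sub>k|\<close> from both sides,
  and the weights from above, hence bounds the initial value of this logarithm.
\<close>

section \<open>Bounds from Cramer's rule\<close>

text \<open>The obstacle is that the algorithm does not know the weights: the spectral condition
  controls \<open>|R|\<close> only in a norm that the rule cannot see. A uniformly random flip is
  indifferent to this, because the mean gain over the mismatched coordinates is compared with the
  very weighted sum that bounds the distance from the maximum. The two greedy rules maximize
  unweighted quantities and are therefore handled with unit weights. The threshold 1/2 has two
  sources. Column k of \<open>(A - Z)^-1\<close> has weighted norm at most \<open>2 r w_k\<close>,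
  so for r < 1/2 the numerator of the gain keeps its sign; and an error term reproduced with factor
  1/2 on both sides can be absorbed. The weights may be exponentially large, but only their
  logarithm enters. Leaving a slack t - s between the spectral bound s and the contraction factor t
  keeps the determinant of \<open>t I - |R|^T\<close> at least (t - s)^n, so that the logarithm is
  O(n^2 log(nL)). This slack depends on the fixed bound alone. All determinant estimates can be as
  crude as n! B^n for the same reason.\<close>

lemma abs_det_le:
  fixes N :: "'a::linordered_idom mat"
  assumes N: "N \<in> carrier_mat n n" and B: "\<And>i j. i < n \<Longrightarrow> j < n \<Longrightarrow> \<bar>N $$ (i, j)\<bar> \<le> B"
  shows "\<bar>det N\<bar> \<le> fact n * B ^ n"
proof -
  let ?P = "{p. p permutes {0..<n}}"
  have "det N = (\<Sum>p\<in>?P. of_int (sign p) * (\<Prod>i = 0..<n. N $$ (i, p i)))"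
    using N by (simp add: det_def)
  also have "\<bar>\<dots>\<bar> \<le> (\<Sum>p\<in>?P. \<bar>of_int (sign p) * (\<Prod>i = 0..<n. N $$ (i, p i))\<bar>)"
    by (rule sum_abs)
  also have "\<dots> \<le> (\<Sum>p\<in>?P. B ^ n)"
  proof (rule sum_mono)
    fix p assume "p \<in> ?P"
    then have p: "\<And>i. i < n \<Longrightarrow> p i < n"
      using permutes_in_image by fastforce
    have "\<bar>of_int (sign p) * (\<Prod>i = 0..<n. N $$ (i, p i))\<bar> = (\<Prod>i = 0..<n. \<bar>N $$ (i, p i)\<bar>)"
      by (simp add: abs_mult abs_prod sign_def)
    also have "\<dots> \<le> (\<Prod>i = 0..<n. B)"
      by (intro prod_mono) (auto intro!: B p)
    finally show "\<bar>of_int (sign p) * (\<Prod>i = 0..<n. N $$ (i, p i))\<bar> \<le> B ^ n"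
      by simp
  qed
  also have "\<dots> = fact n * B ^ n"
    by (simp add: card_permutations)
  finally show ?thesis .
qed

lemma abs_det_replace_col_le:
  fixes N :: "'a::linordered_idom mat"
  assumes N: "N \<in> carrier_mat n n" "c \<in> carrier_vec n" and "k < n"
    and B: "\<And>i j. i < n \<Longrightarrow> j < n \<Longrightarrow> \<bar>N $$ (i, j)\<bar> \<le> B" "\<And>i. i < n \<Longrightarrow> \<bar>c $ i\<bar> \<le> B"
  shows "\<bar>det (replace_col N c k)\<bar> \<le> fact n * B ^ n"
  using assms by (intro abs_det_le) (auto simp: replace_col_def)

text \<open>Cramer's rule as a product, so that each use can supply its own lower bound on the
  determinant: 1 for integer systems, (t - s)^n for the weights.\<close>

lemma cramer_abs_le:
  fixes N :: "'a::linordered_idom mat"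
  assumes N: "N \<in> carrier_mat n n" "x \<in> carrier_vec n" and "k < n"
    and B: "\<And>i j. i < n \<Longrightarrow> j < n \<Longrightarrow> \<bar>N $$ (i, j)\<bar> \<le> B" "\<And>i. i < n \<Longrightarrow> \<bar>(N *\<^sub>v x) $ i\<bar> \<le> B"
  shows "\<bar>x $ k\<bar> * \<bar>det N\<bar> \<le> fact n * B ^ n"
proof -
  have "\<bar>det (replace_col N (N *\<^sub>v x) k)\<bar> \<le> fact n * B ^ n"
    using assms by (intro abs_det_replace_col_le) auto
  then show ?thesis
    using cramer_lemma_mat[OF N \<open>k < n\<close>] by (simp add: abs_mult)
qed

text \<open>A nonzero integer determinant has absolute value at least 1. In Cramer's rule this holds
  for the denominator, which bounds \<open>x $ k\<close> above, and for the numerator when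
  \<open>x $ k\<close> is nonzero, which bounds it below.\<close>

lemma integer_system_bounds:
  fixes N :: "int mat" and c :: "int vec" and x :: "real vec"
  assumes N: "N \<in> carrier_mat n n" and c: "c \<in> carrier_vec n" and x: "x \<in> carrier_vec n"
    and eq: "map_mat real_of_int N *\<^sub>v x = map_vec real_of_int c"
    and det: "det (map_mat real_of_int N) \<noteq> 0"
    and B: "\<And>i j. i < n \<Longrightarrow> j < n \<Longrightarrow> \<bar>N $$ (i, j)\<bar> \<le> B" "\<And>i. i < n \<Longrightarrow> \<bar>c $ i\<bar> \<le> B"
    and k: "k < n"
  shows "\<bar>x $ k\<bar> \<le> fact n * real_of_int B ^ n"
    and "x $ k \<noteq> 0 \<Longrightarrow> 1 \<le> fact n * real_of_int B ^ n * \<bar>x $ k\<bar>"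
proof -
  let ?N = "map_mat real_of_int N"
  have hom: "det ?N = real_of_int (det N)"
    by (rule of_int_hom.hom_det)
  with det have "1 \<le> \<bar>det N\<bar>"
    by (simp add: zero_less_abs_iff flip: int_one_le_iff_zero_less)
  then have det1: "1 \<le> \<bar>det ?N\<bar>"
    unfolding hom by linarith
  have Bn: "\<bar>det ?N\<bar> \<le> fact n * real_of_int B ^ n"
    using N B(1) by (intro abs_det_le) (auto simp flip: of_int_abs)
  have "\<bar>x $ k\<bar> * 1 \<le> \<bar>x $ k\<bar> * \<bar>det ?N\<bar>"
    using det1 by (intro mult_left_mono) auto
  also have "\<dots> \<le> fact n * real_of_int B ^ n"
    using N x k B eq c by (intro cramer_abs_le) (auto simp flip: of_int_abs)
  finally show "\<bar>x $ k\<bar> \<le> fact n * real_of_int B ^ n" by simp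
  assume nz: "x $ k \<noteq> 0"
  have "replace_col ?N (map_vec real_of_int c) k = map_mat real_of_int (replace_col N c k)"
    using N c k by (auto simp: replace_col_def)
  then have "x $ k * det ?N = real_of_int (det (replace_col N c k))"
    using cramer_lemma_mat[of ?N n x k] N x k eq by (simp add: of_int_hom.hom_det)
  moreover have "x $ k * det ?N \<noteq> 0"
    using nz det by simp
  ultimately have "1 \<le> \<bar>x $ k * det ?N\<bar>"
    by (simp flip: of_int_abs)
  also have "\<dots> \<le> \<bar>x $ k\<bar> * (fact n * real_of_int B ^ n)"
    unfolding abs_mult using Bn by (intro mult_left_mono) auto
  finally show "1 \<le> fact n * real_of_int B ^ n * \<bar>x $ k\<bar>"
    by (simp add: mult_ac)
qed

section \<open>Determinants of shifted matrices, and inverses\<close>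

lemma spectral_radius_ge:
  assumes "A \<in> carrier_mat n n" "poly (char_poly A) k = 0"
  shows "cmod k \<le> spectral_radius A"
proof -
  have "eigenvalue A k"
    using assms eigenvalue_root_char_poly by blast
  then show ?thesis
    using assms by (intro spectral_radius_mem_max(2)[of A n] eigenvalue_imp_nonzero_dim)
      (auto simp: spectrum_def)
qed

text \<open>The determinant is the product of t - a over the eigenvalues a with multiplicity, and
  each factor has modulus at least t - s.\<close>

lemma norm_det_shift_ge:
  assumes A: "A \<in> carrier_mat n n" and "spectral_radius A \<le> s" "s < t"
  shows "(t - s) ^ n \<le> cmod (det (complex_of_real t \<cdot>\<^sub>m 1\<^sub>m n - A))"
proof -
  obtain as where cp: "char_poly A = (\<Prod>a\<leftarrow>as. [:- a, 1:])" and len: "length as = n"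
    using char_poly_factorized[OF A] by blast
  have le: "cmod a \<le> s" if "a \<in> set as" for a
    using linear_poly_root[OF that] spectral_radius_ge[OF A, of a] assms(2) by (simp add: cp)
  have "(t - s) ^ length as \<le> cmod (\<Prod>a\<leftarrow>as. complex_of_real t - a)"
    using le
  proof (induction as)
    case (Cons a as)
    have "t - s \<le> cmod (complex_of_real t) - cmod a"
      using Cons.prems[of a] by simp
    also have "\<dots> \<le> cmod (complex_of_real t - a)"
      by (rule norm_triangle_ineq2)
    finally show ?case
      using Cons assms(3) by (auto simp: norm_mult intro!: mult_mono)
  qed simp
  also have "(\<Prod>a\<leftarrow>as. complex_of_real t - a) = poly (char_poly A) (complex_of_real t)"
    unfolding cp by (simp add: poly_prod_list o_def algebra_simps)
  also have "\<dots> = det (- char_matrix A (complex_of_real t))"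
    by (rule char_poly_matrix[OF A])
  also have "- char_matrix A (complex_of_real t) = complex_of_real t \<cdot>\<^sub>m 1\<^sub>m n - A"
    using A by (auto simp: char_matrix_def)
  finally show ?thesis
    by (simp add: len)
qed

lemma mat_inverse_exists:
  fixes A :: "'a::field mat"
  assumes A: "A \<in> carrier_mat n n" and "det A \<noteq> 0"
  shows "\<exists>H. mat_inverse A = Some H \<and> H \<in> carrier_mat n n \<and> A * H = 1\<^sub>m n \<and> H * A = 1\<^sub>m n"
proof (cases "mat_inverse A")
  case None
  then show ?thesis
    using mat_inverse(1)[OF A None, of "()"] det_non_zero_imp_unit[OF assms, of "()"] by simp
next
  case (Some H)
  then show ?thesis
    using mat_inverse(2)[OF A Some] by simp
qed

lemma smult_mat_mult_vec:
  fixes M :: "'a::comm_semiring_0 mat"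
  assumes "M \<in> carrier_mat m n" "x \<in> carrier_vec n"
  shows "(c \<cdot>\<^sub>m M) *\<^sub>v x = c \<cdot>\<^sub>v (M *\<^sub>v x)"
  using assms by (intro eq_vecI) (auto simp: scalar_prod_def sum_distrib_left mult.assoc)

section \<open>Weights contracted by a nonnegative matrix\<close>

lemma eigenvalue_smult:
  fixes A :: "'a::field mat"
  assumes A: "A \<in> carrier_mat n n" and c: "c \<noteq> 0" and ev: "eigenvalue (c \<cdot>\<^sub>m A) k"
  shows "eigenvalue A (k / c)"
proof -
  obtain v where v: "v \<in> carrier_vec n" "v \<noteq> 0\<^sub>v n" "(c \<cdot>\<^sub>m A) *\<^sub>v v = k \<cdot>\<^sub>v v"
    using ev A unfolding eigenvalue_def eigenvector_def by (metis carrier_matD(1) index_smult_mat(2))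
  have "A *\<^sub>v v = (1 / c) \<cdot>\<^sub>v ((c \<cdot>\<^sub>m A) *\<^sub>v v)"
    using A v(1) c by (intro eq_vecI) auto
  also have "\<dots> = (k / c) \<cdot>\<^sub>v v"
    using v by (simp add: smult_smult_assoc)
  finally show ?thesis
    using A v by (auto simp: eigenvalue_def eigenvector_def)
qed

lemma spectral_radius_smult_less_1:
  assumes A: "A \<in> carrier_mat n n" and n: "n > 0" and "spectral_radius A < t" "0 < t"
  shows "spectral_radius ((1 / complex_of_real t) \<cdot>\<^sub>m A) < 1"
proof -
  let ?B = "(1 / complex_of_real t) \<cdot>\<^sub>m A"
  have B: "?B \<in> carrier_mat n n" using A by simp
  obtain k where k: "eigenvalue ?B k" "spectral_radius ?B = cmod k"
    using spectral_radius_mem_max(1)[OF B n] by (auto simp: spectrum_def)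
  have "eigenvalue A (k / (1 / complex_of_real t))"
    using assms by (intro eigenvalue_smult[OF A _ k(1)]) auto
  then have "eigenvalue A (k * complex_of_real t)"
    by simp
  then have "cmod (k * complex_of_real t) < t"
    using spectral_radius_ge[OF A] eigenvalue_root_char_poly[OF A] assms(3) by fastforce
  then show ?thesis
    using k(2) assms(4) by (simp add: norm_mult)
qed

text \<open>After division by t the spectral radius is below 1, where the Jordan normal form bounds
  all powers at once. Decay is obtained later from an extra geometric factor.\<close>

lemma real_power_entries_bounded:
  assumes M: "M \<in> carrier_mat n n" and n: "n > 0" and s: "real_spectral_radius M < t" "0 < t"
  shows "\<exists>c. \<forall>k. \<forall>i<n. \<forall>j<n. \<bar>(((1 / t) \<cdot>\<^sub>m M) ^\<^sub>m k) $$ (i, j)\<bar> \<le> c"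
proof -
  let ?S = "(1 / t) \<cdot>\<^sub>m M"
  let ?c = "map_mat complex_of_real"
  have S: "?S \<in> carrier_mat n n" using M by simp
  have eq: "(1 / complex_of_real t) \<cdot>\<^sub>m ?c M = ?c ?S"
    using M by auto
  have "spectral_radius (?c ?S) < 1"
    unfolding eq[symmetric] using M n s
    by (intro spectral_radius_smult_less_1) (auto simp: real_spectral_radius_def)
  then obtain c where c: "\<And>k. norm_bound (?c ?S ^\<^sub>m k) c"
    using spectral_radius_jnf_norm_bound_less_1_upper_triangular[of "?c ?S" n] S by auto
  have "?c ?S ^\<^sub>m k = ?c (?S ^\<^sub>m k)" for k
    by (rule of_real_hom.mat_hom_pow[OF S, symmetric])
  then have "\<bar>(?S ^\<^sub>m k) $$ (i, j)\<bar> \<le> c" if "i < n" "j < n" for k i j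
    using c[of k] that carrier_matD[OF pow_carrier_mat[OF S, of k]]
    by (simp add: norm_bound_def del: pow_mat_dim)
  then show ?thesis by blast
qed

text \<open>With e the all-ones vector, the solution of \<open>(t I - M) w = t e\<close> works: then
  \<open>M w = t (w - e) <= t w\<close>, and Cramer's rule with the determinant bound limits w from
  above. The delicate point is \<open>w >= e\<close>; it reflects that w is the Neumann series of
  \<open>(M/t)^k e\<close>, whose terms are nonnegative and whose first term is e.\<close>

lemma positive_weights_exist:
  fixes M :: "real mat"
  assumes M: "M \<in> carrier_mat n n" and n: "n > 0"
    and nn: "\<And>i j. i < n \<Longrightarrow> j < n \<Longrightarrow> 0 \<le> M $$ (i, j)"
    and s: "real_spectral_radius M \<le> s" "s < t" "0 < t"
    and B: "t \<le> B" "\<And>i j. i < n \<Longrightarrow> j < n \<Longrightarrow> \<bar>(t \<cdot>\<^sub>m 1\<^sub>m n - M) $$ (i, j)\<bar> \<le> B"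
  shows "\<exists>w \<in> carrier_vec n. \<forall>i<n. 1 \<le> w $ i \<and> w $ i * (t - s) ^ n \<le> fact n * B ^ n \<and>
    (M *\<^sub>v w) $ i \<le> t * w $ i"
proof -
  let ?N = "t \<cdot>\<^sub>m 1\<^sub>m n - M"
  have N: "?N \<in> carrier_mat n n" using M by (rule minus_carrier_mat)
  have "map_mat complex_of_real ?N = complex_of_real t \<cdot>\<^sub>m 1\<^sub>m n - map_mat complex_of_real M"
    using M by (intro eq_matI) auto
  then have "det (complex_of_real t \<cdot>\<^sub>m 1\<^sub>m n - map_mat complex_of_real M) = complex_of_real (det ?N)"
    using of_real_hom.hom_det[of ?N, where ?'a = complex] by simp
  then have det: "(t - s) ^ n \<le> \<bar>det ?N\<bar>"
    using norm_det_shift_ge[of "map_mat complex_of_real M" n s t] M s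
    by (simp add: real_spectral_radius_def)
  have dpos: "0 < (t - s) ^ n"
    using s by simp
  then have "det ?N \<noteq> 0"
    using det by auto
  then obtain P where P: "P \<in> carrier_mat n n" "?N * P = 1\<^sub>m n"
    using mat_inverse_exists[OF N] by blast
  define w where "w = P *\<^sub>v (t \<cdot>\<^sub>v vec n (\<lambda>_. 1))"
  have w: "w \<in> carrier_vec n" using P by (simp add: w_def)
  have Nw: "?N *\<^sub>v w = t \<cdot>\<^sub>v vec n (\<lambda>_. 1)"
    unfolding w_def using N P by (simp flip: assoc_mult_mat_vec)
  have "?N *\<^sub>v w = t \<cdot>\<^sub>v w - M *\<^sub>v w"
    using M w by (subst minus_mult_distrib_mat_vec[of _ n n]) (auto simp: smult_mat_mult_vec[of _ n n])
  then have Mw: "M *\<^sub>v w = t \<cdot>\<^sub>v (w - vec n (\<lambda>_. 1))"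
    using Nw M w by (auto simp: vec_eq_iff algebra_simps)
  \<comment> \<open>A scaling strictly between the spectral radius and t leaves room for bounded
    powers and a geometric factor \<open>\<theta>\<close>; the maximum with t/2 makes it visibly
    positive.\<close>
  define u where "u = (s + t) / 2"
  have u: "real_spectral_radius M < max u (t/2)" "0 < max u (t/2)" "max u (t/2) < t"
  proof -
    have "real_spectral_radius M < u" using s by (simp add: u_def)
    then show "real_spectral_radius M < max u (t/2)" by simp
  qed (use s in \<open>auto simp: u_def\<close>)
  define S where "S = (1 / max u (t/2)) \<cdot>\<^sub>m M"
  define \<theta> where "\<theta> = max u (t/2) / t"
  have th: "0 < \<theta>" "\<theta> < 1" using u s by (auto simp: \<theta>_def)
  have S: "S \<in> carrier_mat n n" using M by (simp add: S_def)
  obtain c where c: "\<And>k i j. i < n \<Longrightarrow> j < n \<Longrightarrow> \<bar>(S ^\<^sub>m k) $$ (i, j)\<bar> \<le> c"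
    using real_power_entries_bounded[OF M n u(1,2)] unfolding S_def by blast
  have Snn: "0 \<le> (S ^\<^sub>m k) $$ (i, j)" if "i < n" "j < n" for i j k
    using that
  proof (induction k arbitrary: i j)
    case (Suc k)
    then show ?case
      using S M nn u(2) pow_carrier_mat[OF S, of k]
      by (auto simp: scalar_prod_def S_def intro!: sum_nonneg)
  qed (use S in auto)
  have Sw: "S *\<^sub>v w = (1 / \<theta>) \<cdot>\<^sub>v (w - vec n (\<lambda>_. 1))"
    using M w u Mw s by (simp add: S_def smult_mat_mult_vec[OF M w] smult_smult_assoc \<theta>_def)
  \<comment> \<open>Since \<open>\<theta> S = M/t\<close>, this is entry i of
    \<open>(M/t)^k w\<close>. As \<open>(M/t) w = w - e\<close>, it decreases in k; it also tends to
    0, so \<open>v 1 i\<close>, which is \<open>w $ i - 1\<close>, is nonnegative.\<close>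
  define v where "v k i = \<theta> ^ k * ((S ^\<^sub>m k) *\<^sub>v w) $ i" for k i
  have step: "v (Suc k) i \<le> v k i" if i: "i < n" for k i
  proof -
    let ?T = "S ^\<^sub>m k"
    have T: "?T \<in> carrier_mat n n" by (rule pow_carrier_mat[OF S])
    have "S ^\<^sub>m Suc k *\<^sub>v w = (1 / \<theta>) \<cdot>\<^sub>v (?T *\<^sub>v w - ?T *\<^sub>v vec n (\<lambda>_. 1))"
      using T S w by (simp add: assoc_mult_mat_vec[OF T S w] Sw mult_mat_vec[OF T] mult_minus_distrib_mat_vec[OF T])
    then have "v (Suc k) i = \<theta> ^ k * ((?T *\<^sub>v w) $ i - (?T *\<^sub>v vec n (\<lambda>_. 1)) $ i)"
      using i T S th by (simp add: v_def)
    moreover have "0 \<le> (?T *\<^sub>v vec n (\<lambda>_. 1)) $ i"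
      using i S T Snn by (auto simp: scalar_prod_def intro!: sum_nonneg)
    ultimately show ?thesis
      using th by (auto simp: v_def intro!: mult_left_mono)
  qed
  have v1: "v 1 i = w $ i - 1" if "i < n" for i
    using that S w th by (simp add: v_def Sw)
  have le: "v (Suc k) i \<le> w $ i - 1" if "i < n" for k i
    by (induction k) (use v1[OF that] step[OF that] in \<open>auto intro: order_trans\<close>)
  have v0: "(\<lambda>k. v k i) \<longlonglongrightarrow> 0" if i: "i < n" for i
  proof (rule Lim_null_comparison)
    let ?K = "c * (\<Sum>j = 0..<n. \<bar>w $ j\<bar>)"
    have "norm (v k i) \<le> \<theta> ^ k * ?K" for k
    proof -
      have T: "S ^\<^sub>m k \<in> carrier_mat n n" by (rule pow_carrier_mat[OF S])
      have "\<bar>((S ^\<^sub>m k) *\<^sub>v w) $ i\<bar> = \<bar>\<Sum>j = 0..<n. (S ^\<^sub>m k) $$ (i, j) * w $ j\<bar>"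
        using T S i w by (simp add: scalar_prod_def)
      also have "\<dots> \<le> (\<Sum>j = 0..<n. \<bar>(S ^\<^sub>m k) $$ (i, j) * w $ j\<bar>)"
        by (rule sum_abs)
      also have "\<dots> \<le> ?K"
        unfolding sum_distrib_left abs_mult using c i by (intro sum_mono mult_right_mono) auto
      finally show ?thesis
        using th by (auto simp: v_def abs_mult intro!: mult_left_mono)
    qed
    then show "\<forall>\<^sub>F k in sequentially. norm (v k i) \<le> \<theta> ^ k * ?K"
      by simp
    show "(\<lambda>k. \<theta> ^ k * ?K) \<longlonglongrightarrow> 0"
      using th by (intro tendsto_mult_left_zero LIMSEQ_realpow_zero) auto
  qed
  have w1: "1 \<le> w $ i" if "i < n" for i
    using LIMSEQ_le_const2[OF LIMSEQ_Suc[OF v0[OF that]], of "w $ i - 1"] le[OF that] by fastforce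
  have "w $ i * (t - s) ^ n \<le> fact n * B ^ n" if i: "i < n" for i
  proof -
    have "w $ i * (t - s) ^ n \<le> \<bar>w $ i\<bar> * \<bar>det ?N\<bar>"
      using det w1[OF i] dpos by (intro mult_mono) auto
    also have "\<dots> \<le> fact n * B ^ n"
      using N w i B s by (intro cramer_abs_le) (auto simp: Nw)
    finally show ?thesis .
  qed
  moreover have "(M *\<^sub>v w) $ i \<le> t * w $ i" if "i < n" for i
    using that w s by (simp add: Mw algebra_simps)
  ultimately show ?thesis
    using w w1 by blast
qed

section \<open>The sign-flip step in a weighted norm\<close>

lemma finite_sign_vecs: "finite (sign_vecs n)"
proof (rule finite_subset)
  show "finite (vec_of_list ` {xs. set xs \<subseteq> {-1, 1::real} \<and> length xs = n})"
    by (intro finite_imageI finite_lists_length_eq) simp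
  show "sign_vecs n \<subseteq> vec_of_list ` {xs. set xs \<subseteq> {-1, 1::real} \<and> length xs = n}"
  proof
    fix z assume z: "z \<in> sign_vecs n"
    then have "set (list_of_vec z) \<subseteq> {-1, 1}"
      by (auto simp: sign_vecs_def in_set_conv_nth list_of_vec_index)
    moreover have "length (list_of_vec z) = n"
      using z by (auto simp: sign_vecs_def)
    ultimately show "z \<in> vec_of_list ` {xs. set xs \<subseteq> {-1, 1::real} \<and> length xs = n}"
      by (intro image_eqI[of _ _ "list_of_vec z"]) (auto simp: vec_list)
  qed
qed

lemma sign_vecsD:
  assumes "z \<in> sign_vecs n"
  shows "z \<in> carrier_vec n" "dim_vec z = n"
    and "i < n \<Longrightarrow> \<bar>z $ i\<bar> = 1" "i < n \<Longrightarrow> z $ i * z $ i = 1"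
  using assms by (auto simp: sign_vecs_def)

lemma sign_vecs_mult:
  assumes "z \<in> sign_vecs n" "i < n"
  shows "z $ i * y < 0 \<Longrightarrow> z $ i * y = - \<bar>y\<bar>" and "0 \<le> z $ i * y \<Longrightarrow> z $ i * y = \<bar>y\<bar>"
proof -
  have "\<bar>z $ i * y\<bar> = \<bar>y\<bar>"
    by (simp add: abs_mult sign_vecsD(3)[OF assms])
  then show "z $ i * y < 0 \<Longrightarrow> z $ i * y = - \<bar>y\<bar>" and "0 \<le> z $ i * y \<Longrightarrow> z $ i * y = \<bar>y\<bar>"
    by linarith+
qed

lemma flip_in_sign_vecs: "z \<in> sign_vecs n \<Longrightarrow> flip S z \<in> sign_vecs n"
  unfolding sign_vecs_def
proof (clarify, intro conjI allI impI)
  fix i assume z: "z \<in> carrier_vec n" and "\<forall>i<n. z $ i \<in> {-1, 1}" "i < n"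
  then have "z $ i \<in> {-1, 1}" "flip S z $ i \<in> {z $ i, - z $ i}"
    by (auto simp: flip_def)
  then show "flip S z $ i \<in> {-1, 1}"
    by auto
qed (simp add: flip_def)

lemma diag_of_carrier: "z \<in> carrier_vec n \<Longrightarrow> diag_of z \<in> carrier_mat n n"
  by (auto simp: diag_of_def mat_diag_def)

lemma index_diag_of_mult_vec:
  assumes "z \<in> carrier_vec n" "x \<in> carrier_vec n" "i < n"
  shows "(diag_of z *\<^sub>v x) $ i = z $ i * x $ i"
proof -
  have "(diag_of z *\<^sub>v x) $ i = (\<Sum>j = 0..<n. (if i = j then z $ j else 0) * x $ j)"
    using assms by (simp add: diag_of_def mat_diag_def scalar_prod_def)
  also have "\<dots> = (\<Sum>j = 0..<n. if i = j then z $ j * x $ j else 0)"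
    by (intro sum.cong) auto
  finally show ?thesis
    using assms by simp
qed

lemma index_minus_diag_of_mult_vec:
  assumes "A \<in> carrier_mat n n" "z \<in> carrier_vec n" "x \<in> carrier_vec n" "i < n"
  shows "((A - diag_of z) *\<^sub>v x) $ i = (A *\<^sub>v x) $ i - z $ i * x $ i"
proof -
  have "(A - diag_of z) *\<^sub>v x = A *\<^sub>v x - diag_of z *\<^sub>v x"
    using assms by (intro minus_mult_distrib_mat_vec[of _ n n]) (auto intro: diag_of_carrier)
  then show ?thesis
    using assms diag_of_carrier[of z n] by (simp add: index_diag_of_mult_vec del: index_mult_mat_vec)
qed

text \<open>By \<open>RA\<close> the matrix \<open>R\<close> inverts \<open>A\<close>, and
  \<open>col\<close> says that the operator norm of \<open>R\<close> in the 1-norm weighted by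
  \<open>w\<close> is at most \<open>r\<close>. The normalization \<open>w_ge\<close> lets a lower
  bound on an entry pass to its weighted size.\<close>

locale ave_contraction =
  fixes n :: nat and A R :: "real mat" and b :: "real vec" and w :: "nat \<Rightarrow> real" and r :: real
  assumes A: "A \<in> carrier_mat n n" and R: "R \<in> carrier_mat n n" and b: "b \<in> carrier_vec n"
    and RA: "R * A = 1\<^sub>m n"
    and w_ge: "i < n \<Longrightarrow> 1 \<le> w i"
    and r: "0 \<le> r" "r < 1 / 2"
    and col: "j < n \<Longrightarrow> (\<Sum>i<n. w i * \<bar>R $$ (i, j)\<bar>) \<le> r * w j"
begin

section \<open>Weighted norm and contraction\<close>

definition wnorm :: "real vec \<Rightarrow> real"
  where "wnorm x = (\<Sum>i<n. w i * \<bar>x $ i\<bar>)"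

lemma w_pos: "i < n \<Longrightarrow> 0 < w i"
  using w_ge by fastforce

lemma wnorm_nonneg: "0 \<le> wnorm x"
  unfolding wnorm_def by (intro sum_nonneg) (auto simp: less_imp_le[OF w_pos])

lemma component_le_wnorm: "k < n \<Longrightarrow> w k * \<bar>x $ k\<bar> \<le> wnorm x"
  unfolding wnorm_def by (rule member_le_sum) (auto simp: less_imp_le[OF w_pos])

lemma wnorm_eq_0:
  assumes "wnorm x \<le> 0" "x \<in> carrier_vec n"
  shows "x = 0\<^sub>v n"
proof -
  have "w k * \<bar>x $ k\<bar> \<le> 0" if "k < n" for k
    using component_le_wnorm[OF that, of x] assms by simp
  then have "x $ k = 0" if "k < n" for k
    using w_pos[OF that] that by (fastforce simp: mult_le_0_iff)
  then show ?thesis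
    using assms by auto
qed

text \<open>Apply \<open>R\<close> to the equation and exchange the sums: what remains are the
  weighted column sums of \<open>|R|\<close>. Stated through \<open>A\<close>, it lets the later
  arguments avoid \<open>R\<close>.\<close>

lemma wnorm_le:
  assumes x: "x \<in> carrier_vec n" and y: "y \<in> carrier_vec n" and eq: "A *\<^sub>v x = y"
  shows "wnorm x \<le> r * wnorm y"
proof -
  have "x = R *\<^sub>v y"
    using assoc_mult_mat_vec[OF R A x] x by (simp add: RA eq)
  then have "wnorm x = (\<Sum>i<n. w i * \<bar>\<Sum>j<n. R $$ (i, j) * y $ j\<bar>)"
    using R y by (auto simp: wnorm_def scalar_prod_def lessThan_atLeast0 intro!: sum.cong)
  also have "\<dots> \<le> (\<Sum>i<n. w i * (\<Sum>j<n. \<bar>R $$ (i, j)\<bar> * \<bar>y $ j\<bar>))"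
    unfolding abs_mult[symmetric]
    by (intro sum_mono mult_left_mono sum_abs) (auto simp: less_imp_le[OF w_pos])
  also have "\<dots> = (\<Sum>i<n. \<Sum>j<n. w i * \<bar>R $$ (i, j)\<bar> * \<bar>y $ j\<bar>)"
    by (simp add: sum_distrib_left mult.assoc)
  also have "\<dots> = (\<Sum>j<n. (\<Sum>i<n. w i * \<bar>R $$ (i, j)\<bar>) * \<bar>y $ j\<bar>)"
    by (subst sum.swap) (simp add: sum_distrib_right)
  also have "\<dots> \<le> (\<Sum>j<n. r * w j * \<bar>y $ j\<bar>)"
    by (intro sum_mono mult_right_mono col) auto
  also have "\<dots> = r * wnorm y"
    by (simp add: wnorm_def sum_distrib_left mult.assoc)
  finally show ?thesis .
qed

text \<open>Otherwise \<open>x\<close> would have weighted norm at most \<open>r\<close> times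
  itself. One criterion serves the kernel of \<open>A - Z\<close>, where \<open>A x = Z x\<close>,
  and the difference of two solutions.\<close>

lemma wnorm_le_imp_zero:
  assumes x: "x \<in> carrier_vec n" and le: "\<And>i. i < n \<Longrightarrow> \<bar>(A *\<^sub>v x) $ i\<bar> \<le> \<bar>x $ i\<bar>"
  shows "x = 0\<^sub>v n"
proof -
  have "wnorm x \<le> r * wnorm (A *\<^sub>v x)"
    using A x by (intro wnorm_le) auto
  also have "\<dots> \<le> r * wnorm x"
    using r le unfolding wnorm_def
    by (intro mult_left_mono sum_mono) (auto simp: less_imp_le[OF w_pos])
  finally have "(1 - r) * wnorm x \<le> 0"
    by (simp add: algebra_simps)
  then have "wnorm x \<le> 0"
    using r by (simp add: mult_le_0_iff)
  then show ?thesis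
    using x by (rule wnorm_eq_0)
qed

lemma det_minus_diag_of_nonzero:
  assumes z: "z \<in> sign_vecs n"
  shows "det (A - diag_of z) \<noteq> 0"
proof
  have M: "A - diag_of z \<in> carrier_mat n n"
    using diag_of_carrier[OF sign_vecsD(1)[OF z]] by (rule minus_carrier_mat)
  assume "det (A - diag_of z) = 0"
  then obtain x where x: "x \<in> carrier_vec n" "x \<noteq> 0\<^sub>v n" "(A - diag_of z) *\<^sub>v x = 0\<^sub>v n"
    using det_0_iff_vec_prod_zero[OF M] by blast
  have "(A *\<^sub>v x) $ i = z $ i * x $ i" if "i < n" for i
    using index_minus_diag_of_mult_vec[OF A sign_vecsD(1)[OF z] x(1) that] that by (simp add: x(3) del: index_mult_mat_vec)
  then have "x = 0\<^sub>v n"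
    using x z by (intro wnorm_le_imp_zero) (auto simp: abs_mult sign_vecsD simp del: index_mult_mat_vec)
  with x show False by simp
qed

section \<open>Inverse and point belonging to a sign vector\<close>

definition inv_at :: "real vec \<Rightarrow> real mat"
  where "inv_at z = mat_inv (A - diag_of z)"

definition pt :: "real vec \<Rightarrow> real vec"
  where "pt z = inv_at z *\<^sub>v b"

lemma inv_at:
  assumes z: "z \<in> sign_vecs n"
  shows "mat_inverse (A - diag_of z) = Some (inv_at z)" "inv_at z \<in> carrier_mat n n"
    "(A - diag_of z) * inv_at z = 1\<^sub>m n" "inv_at z * (A - diag_of z) = 1\<^sub>m n"
proof -
  have "A - diag_of z \<in> carrier_mat n n"
    using diag_of_carrier[OF sign_vecsD(1)[OF z]] by (rule minus_carrier_mat)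
  from mat_inverse_exists[OF this det_minus_diag_of_nonzero[OF z]]
  show "mat_inverse (A - diag_of z) = Some (inv_at z)" "inv_at z \<in> carrier_mat n n"
    "(A - diag_of z) * inv_at z = 1\<^sub>m n" "inv_at z * (A - diag_of z) = 1\<^sub>m n"
    by (auto simp: inv_at_def)
qed

lemma pt_carrier: "z \<in> sign_vecs n \<Longrightarrow> pt z \<in> carrier_vec n"
  unfolding pt_def using inv_at(2) b by (rule mult_mat_vec_carrier)

lemma inv_at_mult_vec_unique:
  assumes z: "z \<in> sign_vecs n" and x: "x \<in> carrier_vec n" and c: "c \<in> carrier_vec n"
    and eq: "\<And>i. i < n \<Longrightarrow> (A *\<^sub>v x) $ i - z $ i * x $ i = c $ i"
  shows "x = inv_at z *\<^sub>v c"
proof -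
  have M: "A - diag_of z \<in> carrier_mat n n"
    using diag_of_carrier[OF sign_vecsD(1)[OF z]] by (rule minus_carrier_mat)
  have "(A - diag_of z) *\<^sub>v x = c"
  proof (rule eq_vecI)
    show "dim_vec ((A - diag_of z) *\<^sub>v x) = dim_vec c"
      using M c by auto
    fix i assume "i < dim_vec c"
    then show "((A - diag_of z) *\<^sub>v x) $ i = c $ i"
      using c eq index_minus_diag_of_mult_vec[OF A sign_vecsD(1)[OF z] x, of i] by (simp del: index_mult_mat_vec)
  qed
  then show ?thesis
    using assoc_mult_mat_vec[OF inv_at(2)[OF z] M x] x by (simp add: inv_at(4)[OF z])
qed

lemma inv_at_mult_vec:
  assumes z: "z \<in> sign_vecs n" and c: "c \<in> carrier_vec n" and i: "i < n"
  shows "(A *\<^sub>v (inv_at z *\<^sub>v c)) $ i = z $ i * (inv_at z *\<^sub>v c) $ i + c $ i"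
proof -
  have M: "A - diag_of z \<in> carrier_mat n n"
    using diag_of_carrier[OF sign_vecsD(1)[OF z]] by (rule minus_carrier_mat)
  have "(A - diag_of z) *\<^sub>v (inv_at z *\<^sub>v c) = c"
    using assoc_mult_mat_vec[OF M inv_at(2)[OF z] c] c by (simp add: inv_at(3)[OF z])
  then show ?thesis
    using index_minus_diag_of_mult_vec[OF A sign_vecsD(1)[OF z] _ i, of "inv_at z *\<^sub>v c"] c inv_at(2)[OF z]
    by (simp del: index_mult_mat_vec)
qed

lemma pt_eq:
  assumes z: "z \<in> sign_vecs n" and "i < n"
  shows "(A *\<^sub>v pt z) $ i = z $ i * pt z $ i + b $ i"
  using inv_at_mult_vec[OF z b] assms by (simp add: pt_def)

section \<open>The potential and its change under one flip\<close>

definition val :: "real vec \<Rightarrow> real"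
  where "val z = (\<Sum>i<n. w i * (z $ i * pt z $ i))"

definition gain :: "real vec \<Rightarrow> nat \<Rightarrow> real"
  where "gain z k = val (flip {k} z) - val z"

text \<open>The 2 is the factor of a sign flip, 1/3 comes from the denominator of the gain being at
  most 3, and 1 - 2r is what remains of \<open>w k\<close> in the numerator.\<close>

definition gain_rate :: real
  where "gain_rate = 2 / 3 * (1 - 2 * r)"

lemma gain_rate: "0 < gain_rate" "gain_rate < 1"
  using r by (auto simp: gain_rate_def)

text \<open>Column k, called h, satisfies \<open>A h = Z h + e_k\<close>, with e_k the unit vector.
  The contraction bounds the norm of h by r times that of \<open>Z h + e_k\<close>, which differs
  from h in absolute values only at position k. Comparing there controls the denominator of the
  gain; comparing whole norms controls its numerator.\<close>

lemma inv_at_col: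
  assumes z: "z \<in> sign_vecs n" and k: "k < n"
  shows "1 + 2 * z $ k * inv_at z $$ (k, k) \<in> {1/3..3}"
    and "\<bar>\<Sum>i<n. w i * (z $ i * inv_at z $$ (i, k))\<bar> \<le> 2 * r * w k"
proof -
  note H = inv_at(2)[OF z]
  define h where "h = inv_at z *\<^sub>v unit_vec n k"
  have h: "h \<in> carrier_vec n" using H by (simp add: h_def)
  have hi: "h $ i = inv_at z $$ (i, k)" if "i < n" for i
    using H that k by (simp add: h_def)
  let ?t = "z $ k * h $ k"
  have Ah: "(A *\<^sub>v h) $ i = z $ i * h $ i + (if i = k then 1 else 0)" if "i < n" for i
    unfolding h_def using inv_at_mult_vec[OF z _ that, of "unit_vec n k"] that k by simp
  let ?rest = "\<Sum>i\<in>{..<n} - {k}. w i * \<bar>h $ i\<bar>"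
  have "wnorm h \<le> r * wnorm (A *\<^sub>v h)"
    using A h by (intro wnorm_le) auto
  also have "wnorm (A *\<^sub>v h) = w k * \<bar>?t + 1\<bar> + (\<Sum>i\<in>{..<n} - {k}. w i * \<bar>z $ i * h $ i\<bar>)"
    unfolding wnorm_def using k by (subst sum.remove[of _ k]) (auto simp: Ah simp del: index_mult_mat_vec)
  also have "(\<Sum>i\<in>{..<n} - {k}. w i * \<bar>z $ i * h $ i\<bar>) = ?rest"
    using z by (intro sum.cong) (auto simp: abs_mult sign_vecsD)
  finally have *: "wnorm h \<le> r * (w k * \<bar>?t + 1\<bar> + ?rest)" .
  have abs_t: "\<bar>?t\<bar> = \<bar>h $ k\<bar>"
    using z k by (simp add: abs_mult sign_vecsD)
  have wn: "wnorm h = w k * \<bar>?t\<bar> + ?rest"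
    unfolding wnorm_def abs_t using k by (subst sum.remove[of _ k]) auto
  \<comment> \<open>The coordinates other than k occur on both sides of \<open>*\<close>, and on the
    right with a factor below 1, so they cancel in favour of coordinate k.\<close>
  have rest: "r * ?rest \<le> 1 * ?rest"
    using r by (intro mult_right_mono sum_nonneg) (auto simp: less_imp_le[OF w_pos])
  have "w k * \<bar>?t\<bar> \<le> w k * (r * \<bar>?t + 1\<bar>)"
    using * rest unfolding wn by (simp add: algebra_simps)
  then have t: "\<bar>?t\<bar> \<le> r * \<bar>?t + 1\<bar>"
    using w_pos[OF k] by simp
  also have "\<dots> \<le> 1 / 2 * \<bar>?t + 1\<bar>"
    using r by (intro mult_right_mono) auto
  finally have t: "\<bar>?t\<bar> \<le> 1 / 2 * \<bar>?t + 1\<bar>" .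
  \<comment> \<open>The inequality confines s to the interval from -1/3 to 1.\<close>
  have "1 + 2 * s \<in> {1/3..3}" if "\<bar>s\<bar> \<le> 1 / 2 * \<bar>s + 1\<bar>" for s :: real
    using that by (auto simp: abs_if split: if_splits)
  from this[OF t] show "1 + 2 * z $ k * inv_at z $$ (k, k) \<in> {1/3..3}"
    using hi[OF k] by (simp add: mult.assoc)
  have "wnorm h \<le> r * (w k * (\<bar>?t\<bar> + 1) + ?rest)"
    using r w_pos[OF k] by (intro order_trans[OF *] mult_left_mono add_right_mono) auto
  also have "\<dots> = r * wnorm h + r * w k"
    unfolding wn by (simp add: algebra_simps)
  also have "r * wnorm h \<le> 1 / 2 * wnorm h"
    using r by (intro mult_right_mono wnorm_nonneg) auto
  finally have wle: "wnorm h \<le> 2 * r * w k"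
    by simp
  have "\<bar>\<Sum>i<n. w i * (z $ i * inv_at z $$ (i, k))\<bar> \<le> (\<Sum>i<n. \<bar>w i * (z $ i * inv_at z $$ (i, k))\<bar>)"
    by (rule sum_abs)
  also have "\<dots> = wnorm h"
    unfolding wnorm_def using z
    by (intro sum.cong) (auto simp: abs_mult hi sign_vecsD abs_of_pos[OF w_pos])
  finally show "\<bar>\<Sum>i<n. w i * (z $ i * inv_at z $$ (i, k))\<bar> \<le> 2 * r * w k"
    using wle by simp
qed

text \<open>Sherman--Morrison: flipping \<open>k\<close> moves the point along the \<open>k\<close>-th column of the inverse.\<close>

lemma gain_eq:
  assumes z: "z \<in> sign_vecs n" and k: "k < n"
  shows "gain z k = - 2 * z $ k * pt z $ k * (w k + (\<Sum>i<n. w i * (z $ i * inv_at z $$ (i, k))))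
    / (1 + 2 * z $ k * inv_at z $$ (k, k))"
proof -
  let ?z = "flip {k} z" and ?h = "\<lambda>i. inv_at z $$ (i, k)"
  note H = inv_at(2)[OF z]
  note z' = flip_in_sign_vecs[OF z, of "{k}"]
  have zi: "?z $ i = (if i = k then - z $ k else z $ i)" if "i < n" for i
    using that sign_vecsD[OF z] by (auto simp: flip_def)
  \<comment> \<open>With Z' the flipped sign matrix and x' its point,
    \<open>(A - Z) x' = b + (Z' - Z) x'\<close>, which alters only entry k of the right-hand side.
    The coefficient involves the new point and is solved for afterwards.\<close>
  define a where "a = - 2 * z $ k * pt ?z $ k"
  have cc: "b + a \<cdot>\<^sub>v unit_vec n k \<in> carrier_vec n"
    using b by simp
  have "pt ?z = inv_at z *\<^sub>v (b + a \<cdot>\<^sub>v unit_vec n k)"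
    using b pt_eq[OF z'] k
    by (intro inv_at_mult_vec_unique[OF z pt_carrier[OF z'] cc]) (auto simp: zi a_def simp del: index_mult_mat_vec)
  also have "\<dots> = pt z + a \<cdot>\<^sub>v (inv_at z *\<^sub>v unit_vec n k)"
    using b H by (simp add: pt_def mult_add_distrib_mat_vec[OF H] mult_mat_vec[OF H])
  finally have pt': "pt ?z $ i = pt z $ i + a * ?h i" if "i < n" for i
    using that H k b by (simp add: pt_def)
  let ?d = "1 + 2 * z $ k * ?h k"
  have d: "?d > 0"
    using inv_at_col(1)[OF z k] by simp
  have "pt ?z $ k * ?d = pt z $ k"
    using pt'[OF k] by (simp add: a_def algebra_simps)
  then have a: "a = - 2 * z $ k * pt z $ k / ?d"
    using d by (simp add: a_def field_simps)
  \<comment> \<open>Writing the old sign in place of the new one at k changes that summand by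
    \<open>- 2 * z $ k * pt ?z $ k\<close>, which is \<open>a\<close> again.\<close>
  have "val ?z = (\<Sum>i<n. w i * (z $ i * pt ?z $ i) + (if i = k then w k * a else 0))"
    unfolding val_def by (intro sum.cong) (auto simp: zi a_def)
  also have "\<dots> = (\<Sum>i<n. w i * (z $ i * pt ?z $ i)) + w k * a"
    using k by (simp add: sum.distrib)
  also have "(\<Sum>i<n. w i * (z $ i * pt ?z $ i)) = (\<Sum>i<n. w i * (z $ i * pt z $ i) + a * (w i * (z $ i * ?h i)))"
    by (intro sum.cong) (auto simp: pt' algebra_simps)
  also have "\<dots> = val z + a * (\<Sum>i<n. w i * (z $ i * ?h i))"
    by (simp add: sum.distrib val_def sum_distrib_left)
  finally have "gain z k = a * (w k + (\<Sum>i<n. w i * (z $ i * ?h i)))"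
    by (simp add: gain_def algebra_simps)
  then show ?thesis
    by (simp add: a)
qed

abbreviation mism :: "real vec \<Rightarrow> nat set"
  where "mism z \<equiv> mismatch z (pt z)"

lemma mism_iff: "z \<in> sign_vecs n \<Longrightarrow> k \<in> mism z \<longleftrightarrow> k < n \<and> z $ k * pt z $ k < 0"
  by (auto simp: mismatch_def sign_vecsD)

lemma finite_mism: "finite (mism z)"
  by (simp add: mismatch_def)

lemma gain_ge:
  assumes z: "z \<in> sign_vecs n" and k: "k \<in> mism z"
  shows "gain_rate * (w k * \<bar>pt z $ k\<bar>) \<le> gain z k"
proof -
  have k': "k < n" and neg: "z $ k * pt z $ k < 0"
    using k z by (auto simp: mism_iff)
  let ?y = "\<Sum>i<n. w i * (z $ i * inv_at z $$ (i, k))" and ?d = "1 + 2 * z $ k * inv_at z $$ (k, k)"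
  have abs: "\<bar>pt z $ k\<bar> = - (z $ k * pt z $ k)"
    using sign_vecs_mult(1)[OF z k' neg] by simp
  have d: "0 < ?d" "?d \<le> 3"
    using inv_at_col(1)[OF z k'] by auto
  have y: "(1 - 2 * r) * w k \<le> w k + ?y"
    using inv_at_col(2)[OF z k'] by (simp add: algebra_simps)
  have "gain_rate * (w k * \<bar>pt z $ k\<bar>) = 2 * \<bar>pt z $ k\<bar> * ((1 - 2 * r) * w k) / 3"
    by (simp add: gain_rate_def)
  also have "\<dots> \<le> 2 * \<bar>pt z $ k\<bar> * (w k + ?y) / 3"
    using y by (intro divide_right_mono mult_left_mono) auto
  also have "\<dots> \<le> 2 * \<bar>pt z $ k\<bar> * (w k + ?y) / ?d"
  proof (intro divide_left_mono)
    have "0 \<le> (1 - 2 * r) * w k" using r w_pos[OF k'] by simp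
    with y have "0 \<le> w k + ?y" by linarith
    then show "0 \<le> 2 * \<bar>pt z $ k\<bar> * (w k + ?y)" by simp
  qed (use d in auto)
  also have "\<dots> = gain z k"
    unfolding gain_eq[OF z k'] abs by simp
  finally show ?thesis .
qed

section \<open>Solutions of the equation and terminal sign vectors\<close>

lemma ave_solution_unique:
  assumes "x \<in> ave_solutions A b" "y \<in> ave_solutions A b"
  shows "x = y"
proof -
  have c: "x \<in> carrier_vec n" "y \<in> carrier_vec n"
    using assms A by (auto simp: ave_solutions_def)
  have eq: "(A *\<^sub>v u) $ i = \<bar>u $ i\<bar> + b $ i" if "u \<in> ave_solutions A b" "i < n" for u i
  proof -
    have "u \<in> carrier_vec n" "A *\<^sub>v u - vec_abs u = b"
      using that A by (auto simp: ave_solutions_def)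
    then have "(A *\<^sub>v u - vec_abs u) $ i = b $ i" "(vec_abs u) $ i = \<bar>u $ i\<bar>" "dim_vec u = n"
      using that by auto
    then show ?thesis
      using that by (simp del: index_mult_mat_vec)
  qed
  have "A *\<^sub>v (x - y) = A *\<^sub>v x - A *\<^sub>v y"
    using c by (rule mult_minus_distrib_mat_vec[OF A])
  \<comment> \<open>Here \<open>A (x - y) = |x| - |y|\<close>, so this is the reverse triangle
    inequality entry by entry.\<close>
  then have "\<bar>(A *\<^sub>v (x - y)) $ i\<bar> \<le> \<bar>(x - y) $ i\<bar>" if "i < n" for i
    using that c A eq[OF assms(1) that] eq[OF assms(2) that] by (simp del: index_mult_mat_vec)
  then have "x - y = 0\<^sub>v n"
    using c by (intro wnorm_le_imp_zero) auto
  have "x $ i = y $ i" if "i < n" for i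
    using arg_cong[OF \<open>x - y = 0\<^sub>v n\<close>, of "\<lambda>v. v $ i"] c that by simp
  then show ?thesis
    using c by auto
qed

text \<open>Without mismatches \<open>Z x = |x|\<close>, so the linear system at \<open>z\<close> is
  the absolute value equation.\<close>

lemma pt_solves:
  assumes z: "z \<in> sign_vecs n" and "mism z = {}"
  shows "pt z \<in> ave_solutions A b" and "i < n \<Longrightarrow> z $ i * pt z $ i = \<bar>pt z $ i\<bar>"
proof -
  have abs: "z $ i * pt z $ i = \<bar>pt z $ i\<bar>" if "i < n" for i
  proof -
    have "0 \<le> z $ i * pt z $ i"
      using that assms mism_iff[OF z, of i] by auto
    then show ?thesis
      by (rule sign_vecs_mult(2)[OF z that])
  qed
  then show "i < n \<Longrightarrow> z $ i * pt z $ i = \<bar>pt z $ i\<bar>" .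
  show "pt z \<in> ave_solutions A b"
    using pt_carrier[OF z] A b pt_eq[OF z]
    by (auto simp: ave_solutions_def abs simp del: index_mult_mat_vec intro!: eq_vecI)
qed

text \<open>The terminal sign vectors are the maximizers of \<open>val\<close>, because every flip strictly increases it.\<close>

definition opt :: "real vec"
  where "opt = (SOME z. z \<in> sign_vecs n \<and> (\<forall>z' \<in> sign_vecs n. val z' \<le> val z))"

lemma opt: "opt \<in> sign_vecs n" "z \<in> sign_vecs n \<Longrightarrow> val z \<le> val opt"
proof -
  have "vec n (\<lambda>_. 1) \<in> sign_vecs n"
    by (auto simp: sign_vecs_def)
  then have "sign_vecs n \<noteq> {}" by blast
  then have "Max (val ` sign_vecs n) \<in> val ` sign_vecs n"
    using finite_sign_vecs by (intro Max_in) auto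
  then obtain y where "y \<in> sign_vecs n" "val y = Max (val ` sign_vecs n)"
    by auto
  then have "\<exists>z. z \<in> sign_vecs n \<and> (\<forall>z' \<in> sign_vecs n. val z' \<le> val z)"
    using finite_sign_vecs by (intro exI[of _ y]) auto
  from someI_ex[OF this] show "opt \<in> sign_vecs n" "z \<in> sign_vecs n \<Longrightarrow> val z \<le> val opt"
    by (auto simp: opt_def)
qed

lemma gain_pos:
  assumes z: "z \<in> sign_vecs n" and k: "k \<in> mism z"
  shows "0 < gain z k"
proof -
  have "0 < w k * \<bar>pt z $ k\<bar>"
    using k z w_pos[of k] by (intro mult_pos_pos) (auto simp: mism_iff)
  with gain_rate(1) have "0 < gain_rate * (w k * \<bar>pt z $ k\<bar>)"
    by (rule mult_pos_pos)
  then show ?thesis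
    using gain_ge[OF assms] by linarith
qed

lemma mism_opt: "mism opt = {}"
proof (rule equals0I)
  fix k assume "k \<in> mism opt"
  from gain_pos[OF opt(1) this] opt(2)[OF flip_in_sign_vecs[OF opt(1)], of "{k}"]
  show False by (simp add: gain_def)
qed

text \<open>Existence comes from the maximizer: it has no mismatch, so its point is a
  solution.\<close>

lemma ave_solutions_eq: "ave_solutions A b = {pt opt}"
  using ave_solution_unique pt_solves(1)[OF opt(1) mism_opt] by blast

lemma pt_terminal: "z \<in> sign_vecs n \<Longrightarrow> mism z = {} \<Longrightarrow> pt z = pt opt"
  using pt_solves(1)[of z] ave_solutions_eq by auto

section \<open>Distance from the maximum\<close>

definition gap :: "real vec \<Rightarrow> real"
  where "gap z = val opt - val z"

lemma gap_nonneg: "z \<in> sign_vecs n \<Longrightarrow> 0 \<le> gap z"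
  using opt(2) by (simp add: gap_def)

lemma gap_flip: "gap (flip {k} z) = gap z - gain z k"
  by (simp add: gap_def gain_def)

lemma gain_le_gap: "z \<in> sign_vecs n \<Longrightarrow> gain z k \<le> gap z"
  using gap_nonneg[OF flip_in_sign_vecs, of z "{k}"] by (simp add: gap_flip)

text \<open>Let x be the solution and y the point at z. Then \<open>A (x - y) = |x| - Z y\<close>,
  which is at most \<open>|x - y| + (|y| - Z y)\<close> in absolute value. With P the weighted sum
  of the defect \<open>|y| - Z y\<close>, the contraction bounds the norm of x - y by P, so the gap
  is at most 2P. The defect is \<open>2 |y|\<close> at a mismatch and 0 elsewhere, whence the factor
  4.\<close>

lemma gap_le:
  assumes z: "z \<in> sign_vecs n"
  shows "gap z \<le> 4 * (\<Sum>i\<in>mism z. w i * \<bar>pt z $ i\<bar>)"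
proof -
  let ?x = "pt opt" and ?y = "pt z"
  note c = pt_carrier[OF opt(1)] pt_carrier[OF z]
  let ?P = "\<Sum>i<n. w i * (\<bar>?y $ i\<bar> - z $ i * ?y $ i)"
  have nn: "0 \<le> \<bar>?y $ i\<bar> - z $ i * ?y $ i" if "i < n" for i
    using abs_ge_self[of "z $ i * ?y $ i"] sign_vecsD(3)[OF z that] by (simp add: abs_mult)
  have "A *\<^sub>v (?x - ?y) = A *\<^sub>v ?x - A *\<^sub>v ?y"
    using c by (rule mult_minus_distrib_mat_vec[OF A])
  then have A_diff: "(A *\<^sub>v (?x - ?y)) $ i = \<bar>?x $ i\<bar> - z $ i * ?y $ i" if "i < n" for i
    using that A c pt_eq[OF opt(1) that] pt_eq[OF z that] pt_solves(2)[OF opt(1) mism_opt that]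
    by (simp del: index_mult_mat_vec)
  have diff: "\<bar>\<bar>?x $ i\<bar> - z $ i * ?y $ i\<bar> \<le> \<bar>(?x - ?y) $ i\<bar> + (\<bar>?y $ i\<bar> - z $ i * ?y $ i)" if "i < n" for i
    using that c nn[OF that] by simp
  have wsum: "(\<Sum>i<n. w i * (\<bar>(?x - ?y) $ i\<bar> + (\<bar>?y $ i\<bar> - z $ i * ?y $ i))) = wnorm (?x - ?y) + ?P"
    by (simp add: wnorm_def distrib_left sum.distrib)
  have P0: "0 \<le> ?P"
    by (intro sum_nonneg mult_nonneg_nonneg less_imp_le[OF w_pos] nn) auto
  \<comment> \<open>Absorbs the distance on the right into the left; with a factor at most 1/2 the
    remaining constant is 1.\<close>
  have halve: "a \<le> p" if "d \<le> e" "e \<le> 1 / 2 * (a + p)" "a \<le> d" for a d e p :: real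
    using that by simp
  have "wnorm (A *\<^sub>v (?x - ?y)) \<le> wnorm (?x - ?y) + ?P"
    unfolding wsum[symmetric] wnorm_def[of "A *\<^sub>v (?x - ?y)"] using diff
    by (intro sum_mono mult_left_mono) (auto simp: A_diff less_imp_le[OF w_pos] simp del: index_mult_mat_vec)
  then have "r * wnorm (A *\<^sub>v (?x - ?y)) \<le> r * (wnorm (?x - ?y) + ?P)"
    using r by (intro mult_left_mono) auto
  moreover have "r * (wnorm (?x - ?y) + ?P) \<le> 1 / 2 * (wnorm (?x - ?y) + ?P)"
    using r P0 wnorm_nonneg[of "?x - ?y"] by (intro mult_right_mono) auto
  moreover have "wnorm (?x - ?y) \<le> r * wnorm (A *\<^sub>v (?x - ?y))"
    using c A by (intro wnorm_le) auto
  ultimately have wP: "wnorm (?x - ?y) \<le> ?P"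
    using halve by blast
  have "gap z = (\<Sum>i<n. w i * (\<bar>?x $ i\<bar> - z $ i * ?y $ i))"
    by (simp add: gap_def val_def pt_solves(2)[OF opt(1) mism_opt] sum_subtractf algebra_simps)
  also have "\<dots> \<le> (\<Sum>i<n. w i * (\<bar>(?x - ?y) $ i\<bar> + (\<bar>?y $ i\<bar> - z $ i * ?y $ i)))"
    using diff abs_le_D1 by (intro sum_mono mult_left_mono) (force simp: less_imp_le[OF w_pos])+
  also have "\<dots> \<le> 2 * ?P"
    unfolding wsum using wP by simp
  also have "?P = (\<Sum>i\<in>mism z. w i * (\<bar>?y $ i\<bar> - z $ i * ?y $ i))"
  proof (rule sum.mono_neutral_right)
    show "\<forall>i\<in>{..<n} - mism z. w i * (\<bar>?y $ i\<bar> - z $ i * ?y $ i) = 0"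
    proof
      fix i assume i: "i \<in> {..<n} - mism z"
      then have "0 \<le> z $ i * ?y $ i"
        using mism_iff[OF z, of i] by auto
      then have "z $ i * ?y $ i = \<bar>?y $ i\<bar>"
        using i by (intro sign_vecs_mult(2)[OF z]) auto
      then show "w i * (\<bar>?y $ i\<bar> - z $ i * ?y $ i) = 0" by simp
    qed
  qed (auto simp: mism_iff[OF z])
  also have "\<dots> = 2 * (\<Sum>i\<in>mism z. w i * \<bar>?y $ i\<bar>)"
    unfolding sum_distrib_left
  proof (rule sum.cong)
    fix i assume "i \<in> mism z"
    then have "i < n" "z $ i * ?y $ i < 0" by (auto simp: mism_iff[OF z])
    then have "z $ i * ?y $ i = - \<bar>?y $ i\<bar>"
      by (intro sign_vecs_mult(1)[OF z])
    then show "w i * (\<bar>?y $ i\<bar> - z $ i * ?y $ i) = 2 * (w i * \<bar>?y $ i\<bar>)" by simp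
  qed simp
  finally show ?thesis by simp
qed

end

section \<open>Logarithmic potential\<close>

lemma nn_integral_bind_spmf:
  "(\<integral>\<^sup>+ y. g y \<partial>measure_spmf (bind_spmf p f)) = (\<integral>\<^sup>+ x. (\<integral>\<^sup>+ y. g y \<partial>measure_spmf (f x)) \<partial>measure_spmf p)"
  unfolding measure_spmf_bind o_def by (rule nn_integral_bind[where B = "count_space UNIV"]) simp_all

text \<open>The lower bound on nonzero entries keeps the gap away from 0 at every nonterminal
  vector; the upper bounds limit it at the start. They enter the complexity only through the
  logarithm of \<open>n W X / m\<close>.\<close>

locale ave_contraction_bounds = ave_contraction +
  fixes m X W :: real
  assumes n_pos: "0 < n" and m_pos: "0 < m"
    and w_le: "i < n \<Longrightarrow> w i \<le> W"
    and pt_ge: "z \<in> sign_vecs n \<Longrightarrow> i < n \<Longrightarrow> pt z $ i \<noteq> 0 \<Longrightarrow> m \<le> \<bar>pt z $ i\<bar>"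
    and pt_le: "z \<in> sign_vecs n \<Longrightarrow> i < n \<Longrightarrow> \<bar>pt z $ i\<bar> \<le> X"
    and m_le_X: "m \<le> X"
begin

lemma W_ge: "1 \<le> W"
  using w_ge[OF n_pos] w_le[OF n_pos] by simp

text \<open>A mismatched entry is nonzero, flipping it gains at least this much, and no gain exceeds
  the gap.\<close>

lemma gap_ge:
  assumes z: "z \<in> sign_vecs n" and ne: "mism z \<noteq> {}"
  shows "gain_rate * m \<le> gap z"
proof -
  from ne obtain k where k: "k \<in> mism z" by auto
  then have k': "k < n" "pt z $ k \<noteq> 0"
    using mism_iff[OF z, of k] by auto
  have "1 * m \<le> w k * \<bar>pt z $ k\<bar>"
    using w_ge[OF k'(1)] pt_ge[OF z k'] m_pos by (intro mult_mono) auto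
  then have "gain_rate * m \<le> gain_rate * (w k * \<bar>pt z $ k\<bar>)"
    using gain_rate(1) by (intro mult_left_mono) auto
  then show ?thesis
    using gain_ge[OF z k] gain_le_gap[OF z, of k] by linarith
qed

lemma gap_upper:
  assumes z: "z \<in> sign_vecs n"
  shows "gap z \<le> 4 * (n * (W * X))"
proof -
  have "(\<Sum>i\<in>mism z. w i * \<bar>pt z $ i\<bar>) \<le> (\<Sum>i<n. w i * \<bar>pt z $ i\<bar>)"
    by (rule sum_mono2) (auto simp: mism_iff[OF z] less_imp_le[OF w_pos])
  also have "\<dots> \<le> (\<Sum>i<n. W * X)"
    using W_ge z by (intro sum_mono mult_mono w_le pt_le) auto
  finally show ?thesis
    using gap_le[OF z] by simp
qed

text \<open>The summand 1 pays for the final step: a jump into a terminal vector, of value 0, must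
  still cost \<open>gain / gap\<close>, which can be as large as 1 while the logarithm may already
  be 0.\<close>

definition lyap :: "real vec \<Rightarrow> real"
  where "lyap z = (if mism z = {} then 0 else 1 + ln (gap z / (gain_rate * m)))"

definition lyap_bound :: real
  where "lyap_bound = 1 + ln (4 * n * W * X / (gain_rate * m))"

lemma gr_m_pos: "0 < gain_rate * m"
  using gain_rate(1) m_pos by simp

lemma lyap_nonneg: "z \<in> sign_vecs n \<Longrightarrow> 0 \<le> lyap z"
  using gap_ge[of z] gr_m_pos by (auto simp: lyap_def intro!: add_nonneg_nonneg ln_ge_zero)

lemma lyap_le:
  assumes z: "z \<in> sign_vecs n"
  shows "lyap z \<le> lyap_bound"
proof (cases "mism z = {}")
  case True
  \<comment> \<open>For a terminal vector the bound has to be nonnegative, and \<open>m_le_X\<close>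
    makes the argument of its logarithm at least 1.\<close>
  have "1 * 1 * m \<le> 4 * n * W * X"
    using W_ge n_pos m_le_X m_pos by (intro mult_mono) auto
  moreover have "gain_rate * m \<le> 1 * m"
    using gain_rate m_pos by (intro mult_right_mono) auto
  ultimately have "1 \<le> 4 * n * W * X / (gain_rate * m)"
    using gr_m_pos by simp
  then have "0 \<le> ln (4 * n * W * X / (gain_rate * m))"
    by (rule ln_ge_zero)
  then show ?thesis
    using True by (simp add: lyap_def lyap_bound_def)
next
  case False
  then have "0 < gap z"
    using gap_ge[OF z] gr_m_pos by linarith
  then have "ln (gap z / (gain_rate * m)) \<le> ln (4 * n * W * X / (gain_rate * m))"
    using gap_upper[OF z] gr_m_pos by (intro ln_mono divide_right_mono) (auto simp: mult.assoc)
  then show ?thesis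
    using False by (simp add: lyap_def lyap_bound_def)
qed

text \<open>The gap shrinks by the factor 1 - q with q = gain / gap, and ln (1 - q) <= -q. The
  decrease is linear in the gain, so it can be averaged over flips as it stands.\<close>

lemma lyap_flip:
  assumes z: "z \<in> sign_vecs n" and k: "k \<in> mism z"
  shows "lyap (flip {k} z) \<le> lyap z - gain z k / gap z"
proof -
  let ?z = "flip {k} z"
  have z': "?z \<in> sign_vecs n"
    by (rule flip_in_sign_vecs[OF z])
  have g: "gain_rate * m \<le> gap z"
    using gap_ge[OF z] k by blast
  then have gpos: "0 < gap z" using gr_m_pos by linarith
  have lz: "lyap z = 1 + ln (gap z / (gain_rate * m))"
    using k by (auto simp: lyap_def)
  have ratio: "gap ?z / gap z = 1 - gain z k / gap z"
    using gpos by (simp add: gap_flip diff_divide_distrib)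
  show ?thesis
  proof (cases "mism ?z = {}")
    case True
    have "0 \<le> ln (gap z / (gain_rate * m))"
      using g gr_m_pos by (intro ln_ge_zero) simp
    moreover have "gain z k / gap z \<le> 1"
      using gain_le_gap[OF z] gpos by simp
    ultimately show ?thesis
      using True by (simp add: lyap_def[of ?z] lz)
  next
    case False
    then have g': "0 < gap ?z"
      using gap_ge[OF z'] gr_m_pos by linarith
    have "ln (gap ?z / (gain_rate * m)) = ln (gap z / (gain_rate * m)) + ln (gap ?z / gap z)"
      using g' gpos gr_m_pos gain_rate(1) m_pos by (subst ln_mult_pos[symmetric]) (auto simp: field_simps)
    also have "ln (gap ?z / gap z) \<le> gap ?z / gap z - 1"
      using g' gpos by (intro ln_le_minus_one) simp
    finally show ?thesis
      using False by (simp add: lyap_def[of ?z] lz ratio)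
  qed
qed

text \<open>The fraction of the gap gained by an average flip: the 4 is the constant of
  \<open>gap_le\<close>, and n bounds the number of mismatches.\<close>

definition rate :: real
  where "rate = gain_rate / (4 * n)"

lemma rate_pos: "0 < rate"
  using gain_rate(1) n_pos by (simp add: rate_def)

text \<open>The weighted sum over the mismatches bounds the gap above and the total gain below, so
  the weights drop out of the comparison.\<close>

lemma sum_gain_ge:
  assumes z: "z \<in> sign_vecs n"
  shows "n * (rate * gap z) \<le> (\<Sum>k\<in>mism z. gain z k)"
proof -
  have "n * (rate * gap z) = gain_rate / 4 * gap z"
    using n_pos by (simp add: rate_def)
  also have "\<dots> \<le> gain_rate / 4 * (4 * (\<Sum>k\<in>mism z. w k * \<bar>pt z $ k\<bar>))"
    using gain_rate(1) gap_le[OF z] by (intro mult_left_mono) auto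
  also have "\<dots> = (\<Sum>k\<in>mism z. gain_rate * (w k * \<bar>pt z $ k\<bar>))"
    by (simp add: sum_distrib_left)
  also have "\<dots> \<le> (\<Sum>k\<in>mism z. gain z k)"
    by (intro sum_mono gain_ge[OF z])
  finally show ?thesis .
qed

lemma card_mism_le: "z \<in> sign_vecs n \<Longrightarrow> card (mism z) \<le> n"
  using card_mono[of "{..<n}" "mism z"] by (auto simp: mism_iff subset_iff)

section \<open>Deterministic rules with guaranteed progress\<close>

definition good_rule :: "flip_rule \<Rightarrow> bool"
  where "good_rule rule \<longleftrightarrow> (\<forall>z\<in>sign_vecs n.
    (mism z \<noteq> {} \<longrightarrow> (\<exists>S. S \<noteq> {} \<and> S \<subseteq> mism z \<and> rule (inv_at z) (pt z) z S)) \<and>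
    (\<forall>S. rule (inv_at z) (pt z) z S \<longrightarrow> S \<subseteq> mism z \<longrightarrow> S \<noteq> {} \<longrightarrow>
       (\<exists>k \<in> mism z. S = {k} \<and> rate * gap z \<le> gain z k)))"

lemma sign_flip_returns_iff:
  assumes z: "z \<in> sign_vecs n"
  shows "sign_flip_returns A b z x \<longleftrightarrow> x = pt z \<and> mism z = {}"
  by (auto simp: sign_flip_returns_def inv_at(1)[OF z] pt_def)

text \<open>Dividing the guaranteed gain by the gap, which is positive at a mismatch, turns relative
  progress into a fixed decrease of the logarithm.\<close>

lemma good_rule_step:
  assumes good: "good_rule rule" and z: "z \<in> sign_vecs n"
    and step: "sign_flip_step rule A b z z'"
  shows "z' \<in> sign_vecs n" and "lyap z' + rate \<le> lyap z"
proof -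
  obtain S where S: "z' = flip S z" "S \<noteq> {}" "S \<subseteq> mism z" "rule (inv_at z) (pt z) z S"
    using step by cases (auto simp: inv_at(1)[OF z] pt_def)
  show "z' \<in> sign_vecs n"
    using flip_in_sign_vecs[OF z] by (simp add: S(1))
  from bspec[OF good[unfolded good_rule_def] z] S(2-4)
  obtain k where k: "k \<in> mism z" "S = {k}" "rate * gap z \<le> gain z k"
    by auto
  have "0 < gap z"
    using gap_ge[OF z] gr_m_pos k(1) by force
  then have "rate \<le> gain z k / gap z"
    using k(3) by (simp add: field_simps)
  then show "lyap z' + rate \<le> lyap z"
    using lyap_flip[OF z k(1)] by (simp add: S(1) k(2))
qed

lemma good_rule_steps:
  assumes good: "good_rule rule" and z: "z \<in> sign_vecs n"
    and steps: "(sign_flip_step rule A b ^^ k) z z'"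
  shows "z' \<in> sign_vecs n \<and> lyap z' + k * rate \<le> lyap z"
  using steps
proof (induction k arbitrary: z')
  case 0
  then show ?case using z by simp
next
  case (Suc k)
  then obtain y where y: "(sign_flip_step rule A b ^^ k) z y" "sign_flip_step rule A b y z'"
    by auto
  then have "y \<in> sign_vecs n" "lyap y + k * rate \<le> lyap z"
    using Suc.IH by auto
  then show ?case
    using good_rule_step[OF good _ y(2)] by (auto simp: algebra_simps)
qed

lemma good_rule_terminates:
  assumes good: "good_rule rule" and z: "z \<in> sign_vecs n" and N: "lyap_bound / rate \<le> N"
  shows "sign_flip_terminates rule A b z (pt opt) N"
  unfolding sign_flip_terminates_def
proof (intro allI impI conjI)
  fix k z' assume "(sign_flip_step rule A b ^^ k) z z'"
  from good_rule_steps[OF good z this]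
  have z': "z' \<in> sign_vecs n" and le: "lyap z' + k * rate \<le> lyap z" by auto
  have "k * rate \<le> lyap_bound"
    using le lyap_nonneg[OF z'] lyap_le[OF z] by linarith
  then have "k \<le> lyap_bound / rate"
    using rate_pos by (simp add: field_simps)
  then show "real k \<le> N" using N by linarith
  show "sign_flip_returns A b z' (pt opt) \<or> (\<exists>z''. sign_flip_step rule A b z' z'')"
  proof (cases "mism z' = {}")
    case True
    then show ?thesis
      using pt_terminal[OF z'] by (simp add: sign_flip_returns_iff[OF z'])
  next
    case False
    with bspec[OF good[unfolded good_rule_def] z']
    obtain S where "S \<noteq> {}" "S \<subseteq> mism z'" "rule (inv_at z') (pt z') z' S"
      by auto
    then have "sign_flip_step rule A b z' (flip S z')"
      by (intro sign_flip_step.intros[OF inv_at(1)[OF z']]) (auto simp: pt_def)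
    then show ?thesis by blast
  qed
qed

text \<open>Both deterministic rules pick a maximizer of a score over a finite set, so a choice
  exists whenever there is a mismatch. What differs is why a maximizer gains enough.\<close>

lemma good_ruleI:
  fixes score :: "real mat \<Rightarrow> real vec \<Rightarrow> real vec \<Rightarrow> nat \<Rightarrow> real"
  assumes rule: "\<And>H x z S. rule H x z S \<longleftrightarrow>
      (\<exists>k. S = {k} \<and> is_arg_max (score H x z) (\<lambda>i. i \<in> mismatch z x) k)"
    and best: "\<And>z k. z \<in> sign_vecs n \<Longrightarrow> k \<in> mism z \<Longrightarrow>
      (\<And>i. i \<in> mism z \<Longrightarrow> score (inv_at z) (pt z) z i \<le> score (inv_at z) (pt z) z k) \<Longrightarrow>
      rate * gap z \<le> gain z k"
  shows "good_rule rule"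
  unfolding good_rule_def
proof (intro ballI conjI impI allI)
  fix z assume z: "z \<in> sign_vecs n"
  let ?f = "score (inv_at z) (pt z) z"
  show "\<exists>S. S \<noteq> {} \<and> S \<subseteq> mism z \<and> rule (inv_at z) (pt z) z S" if "mism z \<noteq> {}"
  proof -
    have "Max (?f ` mism z) \<in> ?f ` mism z"
      using that finite_mism by (intro Max_in) auto
    then obtain k where k: "k \<in> mism z" "?f k = Max (?f ` mism z)"
      by auto
    then have "is_arg_max ?f (\<lambda>i. i \<in> mism z) k"
      using finite_mism by (auto simp: is_arg_max_linorder)
    with k show ?thesis
      by (intro exI[of _ "{k}"]) (auto simp: rule)
  qed
  fix S assume "rule (inv_at z) (pt z) z S" "S \<subseteq> mism z"
  then obtain k where k: "S = {k}" "k \<in> mism z" "is_arg_max ?f (\<lambda>i. i \<in> mism z) k"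
    by (auto simp: rule)
  then have "rate * gap z \<le> gain z k"
    using best[OF z k(2)] by (auto simp: is_arg_max_linorder)
  with k show "\<exists>k \<in> mism z. S = {k} \<and> rate * gap z \<le> gain z k"
    by blast
qed

text \<open>For unit weights the largest \<open>|x_k|\<close> is also the largest term of the sum in
  \<open>gap_le\<close>, hence at least its average.\<close>

lemma good_gauss_southwell:
  assumes w1: "\<And>i. i < n \<Longrightarrow> w i = 1"
  shows "good_rule gauss_southwell_rule"
proof (rule good_ruleI)
  show "gauss_southwell_rule H x z S \<longleftrightarrow>
      (\<exists>k. S = {k} \<and> is_arg_max (\<lambda>i. \<bar>x $ i\<bar>) (\<lambda>i. i \<in> mismatch z x) k)" for H x z S
    by (simp add: gauss_southwell_rule_def)
  fix z k assume z: "z \<in> sign_vecs n" and k: "k \<in> mism z"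
    and best: "\<And>i. i \<in> mism z \<Longrightarrow> \<bar>pt z $ i\<bar> \<le> \<bar>pt z $ k\<bar>"
  have "(\<Sum>i\<in>mism z. w i * \<bar>pt z $ i\<bar>) \<le> (\<Sum>i\<in>mism z. \<bar>pt z $ k\<bar>)"
    using best z by (intro sum_mono) (auto simp: w1 mism_iff)
  also have "\<dots> \<le> n * \<bar>pt z $ k\<bar>"
    using card_mism_le[OF z] by (simp add: mult_right_mono)
  finally have "gap z \<le> 4 * (n * \<bar>pt z $ k\<bar>)"
    using gap_le[OF z] by linarith
  then have "rate * gap z \<le> rate * (4 * (n * \<bar>pt z $ k\<bar>))"
    using rate_pos by (intro mult_left_mono) auto
  also have "\<dots> = gain_rate * (w k * \<bar>pt z $ k\<bar>)"
    using n_pos k z by (simp add: rate_def w1 mism_iff)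
  also have "\<dots> \<le> gain z k"
    by (rule gain_ge[OF z k])
  finally show "rate * gap z \<le> gain z k" .
qed

text \<open>For unit weights the score is exactly the gain computed in \<open>gain_eq\<close>, and
  the largest gain is at least the mean one.\<close>

lemma good_steepest:
  assumes w1: "\<And>i. i < n \<Longrightarrow> w i = 1"
  shows "good_rule steepest_rule"
proof (rule good_ruleI)
  let ?score = "\<lambda>H x z i. (- 2 * z $ i * x $ i * (1 + (transpose_mat H *\<^sub>v z) $ i)) / (1 + 2 * z $ i * H $$ (i, i))"
  show "steepest_rule H x z S \<longleftrightarrow>
      (\<exists>k. S = {k} \<and> is_arg_max (?score H x z) (\<lambda>i. i \<in> mismatch z x) k)" for H x z S
    by (simp add: steepest_rule_def Let_def)
  fix z k assume z: "z \<in> sign_vecs n" and k: "k \<in> mism z"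
    and best: "\<And>i. i \<in> mism z \<Longrightarrow> ?score (inv_at z) (pt z) z i \<le> ?score (inv_at z) (pt z) z k"
  have score: "?score (inv_at z) (pt z) z i = gain z i" if "i \<in> mism z" for i
  proof -
    have i: "i < n" using that mism_iff[OF z, of i] by auto
    have "(transpose_mat (inv_at z) *\<^sub>v z) $ i = (\<Sum>j<n. inv_at z $$ (j, i) * z $ j)"
      using i inv_at(2)[OF z] sign_vecsD(2)[OF z] by (simp add: scalar_prod_def lessThan_atLeast0)
    also have "\<dots> = (\<Sum>j<n. w j * (z $ j * inv_at z $$ (j, i)))"
      by (intro sum.cong) (auto simp: w1)
    finally show ?thesis
      using i by (simp add: gain_eq[OF z i] w1)
  qed
  have best': "gain z i \<le> gain z k" if "i \<in> mism z" for i
    using best[OF that] by (simp only: score[OF k] score[OF that])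
  have "n * (rate * gap z) \<le> (\<Sum>i\<in>mism z. gain z i)"
    by (rule sum_gain_ge[OF z])
  also have "\<dots> \<le> (\<Sum>i\<in>mism z. gain z k)"
    by (intro sum_mono best')
  also have "\<dots> \<le> n * gain z k"
    using card_mism_le[OF z] gain_pos[OF z k] by (simp add: mult_right_mono)
  finally show "rate * gap z \<le> gain z k"
    using n_pos by simp
qed

section \<open>Expected number of random flips\<close>

lemma mean_lyap_flip:
  assumes z: "z \<in> sign_vecs n" and ne: "mism z \<noteq> {}"
  shows "(\<Sum>k\<in>mism z. lyap (flip {k} z)) / card (mism z) + rate \<le> lyap z"
proof -
  let ?V = "mism z"
  have c: "0 < card ?V"
    using ne finite_mism by (simp add: card_gt_0_iff)
  have g: "0 < gap z"
    using gap_ge[OF z ne] gr_m_pos by linarith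
  \<comment> \<open>The total gain is at least n times \<open>rate * gap z\<close>; averaging it
    over no more than n mismatches leaves at least \<open>rate * gap z\<close>.\<close>
  have "card ?V * rate \<le> n * rate"
    using card_mism_le[OF z] rate_pos by (intro mult_right_mono) auto
  also have "\<dots> \<le> (\<Sum>k\<in>?V. gain z k) / gap z"
    using sum_gain_ge[OF z] g by (simp add: field_simps)
  finally have "card ?V * rate \<le> (\<Sum>k\<in>?V. gain z k / gap z)"
    by (simp add: sum_divide_distrib)
  moreover have "(\<Sum>k\<in>?V. lyap (flip {k} z)) \<le> (\<Sum>k\<in>?V. lyap z - gain z k / gap z)"
    by (intro sum_mono lyap_flip[OF z])
  ultimately have "(\<Sum>k\<in>?V. lyap (flip {k} z)) + card ?V * rate \<le> card ?V * lyap z"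
    by (simp add: sum_subtractf)
  then show ?thesis
    using c by (simp add: field_simps)
qed

text \<open>Every flip strictly increases \<open>val\<close>, so the number of sign vectors of
  larger value decreases along every run. This gives an induction in which the program is unfolded
  once, and all three claims pass from the successors to \<open>z\<close>.\<close>

lemma randomized_sign_flip_correct:
  assumes "z \<in> sign_vecs n"
  shows "lossless_spmf (randomized_sign_flip A b z) \<and>
    fst ` set_spmf (randomized_sign_flip A b z) = {pt opt} \<and>
    randomized_expected_iterations A b z \<le> ennreal (lyap z / rate)"
  using assms
proof (induction "card {y \<in> sign_vecs n. val z < val y}" arbitrary: z rule: less_induct)
  case less
  note z = less.prems
  let ?V = "mism z"
  have unfold: "randomized_sign_flip A b z =
      (if ?V = {} then return_spmf (pt z, 0)
       else bind_spmf (spmf_of_set ?V) (\<lambda>k.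
         map_spmf (\<lambda>(x', m). (x', Suc m)) (randomized_sign_flip A b (flip {k} z))))"
    by (subst randomized_sign_flip.simps) (simp add: inv_at(1)[OF z] pt_def Let_def)
  show ?case
  proof (cases "?V = {}")
    case True
    then show ?thesis
      using pt_terminal[OF z True] lyap_nonneg[OF z] rate_pos
      by (simp add: unfold randomized_expected_iterations_def measure_spmf_return_spmf nn_integral_return)
  next
    case False
    have fin: "finite ?V" by (rule finite_mism)
    have z': "flip {k} z \<in> sign_vecs n" for k
      by (rule flip_in_sign_vecs[OF z])
    have IH: "lossless_spmf (randomized_sign_flip A b (flip {k} z))"
      "fst ` set_spmf (randomized_sign_flip A b (flip {k} z)) = {pt opt}"
      "randomized_expected_iterations A b (flip {k} z) \<le> ennreal (lyap (flip {k} z) / rate)"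
      if k: "k \<in> ?V" for k
    proof -
      have lt: "val z < val (flip {k} z)"
        using gain_pos[OF z k] by (simp add: gain_def)
      have "card {y \<in> sign_vecs n. val (flip {k} z) < val y} < card {y \<in> sign_vecs n. val z < val y}"
        using finite_sign_vecs[of n] lt z'[of k] by (intro psubset_card_mono) auto
      from less.hyps[OF this z'] show "lossless_spmf (randomized_sign_flip A b (flip {k} z))"
        "fst ` set_spmf (randomized_sign_flip A b (flip {k} z)) = {pt opt}"
        "randomized_expected_iterations A b (flip {k} z) \<le> ennreal (lyap (flip {k} z) / rate)"
        by auto
    qed
    let ?p = "\<lambda>k. randomized_sign_flip A b (flip {k} z)"
    have "lossless_spmf (randomized_sign_flip A b z)"
      using False fin IH(1) by (simp add: unfold)
    moreover have "fst ` set_spmf (randomized_sign_flip A b z) = {pt opt}"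
    proof -
      have "fst ` set_spmf (randomized_sign_flip A b z) = (\<Union>k\<in>?V. fst ` set_spmf (?p k))"
        using False fin by (simp add: unfold set_bind_spmf bind_UNION image_UN image_image split_beta o_def)
      then show ?thesis
        using False IH(2) by simp
    qed
    moreover have "randomized_expected_iterations A b z \<le> ennreal (lyap z / rate)"
    proof -
      have E: "(\<integral>\<^sup>+ (x, m). of_nat m \<partial>measure_spmf (map_spmf (\<lambda>(x', m). (x', Suc m)) (?p k)))
          \<le> ennreal (1 + lyap (flip {k} z) / rate)" if k: "k \<in> ?V" for k
      proof -
        have "(\<integral>\<^sup>+ (x, m). of_nat m \<partial>measure_spmf (map_spmf (\<lambda>(x', m). (x', Suc m)) (?p k)))
          = (\<integral>\<^sup>+ y. 1 + of_nat (snd y) \<partial>measure_spmf (?p k))"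
          by (simp add: split_beta o_def)
        \<comment> \<open>The \<open>Suc\<close> contributes the total mass of the remaining run,
          which is 1 because that run is lossless.\<close>
        also have "\<dots> = 1 + randomized_expected_iterations A b (flip {k} z)"
          using lossless_weight_spmfD[OF IH(1)[OF k]]
          by (simp add: nn_integral_add randomized_expected_iterations_def case_prod_unfold
              measure_spmf.emeasure_eq_measure weight_spmf_def)
        also have "\<dots> \<le> 1 + ennreal (lyap (flip {k} z) / rate)"
          by (intro add_left_mono IH(3)[OF k])
        also have "\<dots> = ennreal (1 + lyap (flip {k} z) / rate)"
          using lyap_nonneg[OF z'] rate_pos by (simp add: ennreal_plus)
        finally show ?thesis .
      qed
      have "randomized_expected_iterations A b z =
          (\<integral>\<^sup>+ k. (\<integral>\<^sup>+ (x, m). of_nat m \<partial>measure_spmf (map_spmf (\<lambda>(x', m). (x', Suc m)) (?p k)))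
             \<partial>measure_spmf (spmf_of_set ?V))"
        using False by (simp add: randomized_expected_iterations_def unfold nn_integral_bind_spmf)
      also have "\<dots> = (\<Sum>k\<in>?V. \<integral>\<^sup>+ (x, m). of_nat m
            \<partial>measure_spmf (map_spmf (\<lambda>(x', m). (x', Suc m)) (?p k))) / of_nat (card ?V)"
        by (rule nn_integral_spmf_of_set)
      also have "\<dots> \<le> (\<Sum>k\<in>?V. ennreal (1 + lyap (flip {k} z) / rate)) / of_nat (card ?V)"
        by (intro divide_right_mono_ennreal sum_mono E)
      also have "\<dots> = ennreal ((\<Sum>k\<in>?V. 1 + lyap (flip {k} z) / rate) / card ?V)"
      proof -
        have nn: "0 \<le> 1 + lyap (flip {k} z) / rate" for k
          using lyap_nonneg[OF z', of k] rate_pos by simp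
        have "0 < real (card ?V)"
          using False fin by (simp add: card_gt_0_iff)
        then show ?thesis
          unfolding sum_ennreal[OF nn] ennreal_of_nat_eq_real_of_nat
          by (intro divide_ennreal sum_nonneg nn)
      qed
      \<comment> \<open>The iteration just made costs 1, which is the expected decrease
        \<open>rate\<close> of \<open>lyap\<close> divided by \<open>rate\<close>.\<close>
      also have "\<dots> \<le> ennreal (lyap z / rate)"
      proof (rule ennreal_leI)
        have "(\<Sum>k\<in>?V. 1 + lyap (flip {k} z) / rate) / card ?V
            = ((\<Sum>k\<in>?V. lyap (flip {k} z)) / card ?V + rate) / rate"
          using False fin rate_pos
          by (simp add: sum.distrib add_divide_distrib flip: sum_divide_distrib)
        also have "\<dots> \<le> lyap z / rate"
          using mean_lyap_flip[OF z False] rate_pos by (intro divide_right_mono) auto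
        finally show "(\<Sum>k\<in>?V. 1 + lyap (flip {k} z) / rate) / card ?V \<le> lyap z / rate" .
      qed
      finally show ?thesis .
    qed
    ultimately show ?thesis by blast
  qed
qed

end

section \<open>Rational linear complementarity problems\<close>

lemma invertible_mat_det_nonzero:
  fixes M :: "'a::field mat"
  assumes M: "M \<in> carrier_mat n n" and inv: "invertible_mat M"
  shows "det M \<noteq> 0"
proof -
  obtain P where P: "M * P = 1\<^sub>m n" "P * M = 1\<^sub>m (dim_row P)"
    using M inv by (auto simp: invertible_mat_def inverts_mat_def)
  have "dim_row P = n"
    using arg_cong[OF P(2), of dim_col] M by simp
  moreover have "dim_col P = n"
    using arg_cong[OF P(1), of dim_col] by simp
  ultimately have "P \<in> carrier_mat n n"
    by auto
  then have "det M * det P = 1"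
    using det_mult[OF M] P(1) by (metis det_one)
  then show ?thesis by auto
qed

locale rational_lcp =
  fixes n :: nat and Qbar :: "int mat" and qbar :: "int vec" and d_Q d_q L :: int
    and Q :: "real mat" and q :: "real vec"
  assumes n_pos: "0 < n"
    and Qbar: "Qbar \<in> carrier_mat n n" and qbar: "qbar \<in> carrier_vec n"
    and d_Q: "0 < d_Q" and d_q: "0 < d_q"
    and Q_def: "Q = (1 / real_of_int d_Q) \<cdot>\<^sub>m map_mat real_of_int Qbar"
    and q_def: "q = (1 / real_of_int d_q) \<cdot>\<^sub>v map_vec real_of_int qbar"
    and inv_minus: "invertible_mat (1\<^sub>m n - Q)" and inv_plus: "invertible_mat (1\<^sub>m n + Q)"
    and L_def: "L = Max {d_q, d_Q, norm_inf_vec qbar, norm_max_mat Qbar}"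
begin

abbreviation A :: "real mat" where "A \<equiv> ave_mat Q"
abbreviation b :: "real vec" where "b \<equiv> ave_rhs Q q"
abbreviation R :: "real mat" where "R \<equiv> cayley Q"

lemma Q: "Q \<in> carrier_mat n n"
  using Qbar by (simp add: Q_def)

lemma q: "q \<in> carrier_vec n"
  using qbar by (simp add: q_def)

lemma IQ: "1\<^sub>m n - Q \<in> carrier_mat n n" "1\<^sub>m n + Q \<in> carrier_mat n n"
  using Q by (auto intro: minus_carrier_mat)

lemma entry_bounds:
  shows "1 \<le> L" "d_Q \<le> L" "d_q \<le> L"
    and "i < n \<Longrightarrow> j < n \<Longrightarrow> \<bar>Qbar $$ (i, j)\<bar> \<le> L"
    and "i < n \<Longrightarrow> \<bar>qbar $ i\<bar> \<le> L"
proof -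
  show "d_Q \<le> L" "d_q \<le> L" by (simp_all add: L_def)
  then show "1 \<le> L" using d_Q by linarith
  have *: "norm_inf_vec qbar \<le> L" "norm_max_mat Qbar \<le> L" by (simp_all add: L_def)
  show "\<bar>Qbar $$ (i, j)\<bar> \<le> L" if "i < n" "j < n"
  proof -
    have "\<bar>Qbar $$ (i, j)\<bar> \<le> norm_max_mat Qbar"
      unfolding norm_max_mat_def using Qbar that by (intro Max_ge) force+
    with * show ?thesis by linarith
  qed
  show "\<bar>qbar $ i\<bar> \<le> L" if "i < n"
  proof -
    have "\<bar>qbar $ i\<bar> \<le> norm_inf_vec qbar"
      unfolding norm_inf_vec_def using qbar that by (intro Max_ge) force+
    with * show ?thesis by linarith
  qed
qed

definition P :: "real mat" where "P = mat_inv (1\<^sub>m n - Q)"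
definition S :: "real mat" where "S = mat_inv (1\<^sub>m n + Q)"

lemma P: "P \<in> carrier_mat n n" "(1\<^sub>m n - Q) * P = 1\<^sub>m n" "P * (1\<^sub>m n - Q) = 1\<^sub>m n"
  using mat_inverse_exists[OF IQ(1) invertible_mat_det_nonzero[OF IQ(1) inv_minus]]
  by (auto simp: P_def)

lemma S: "S \<in> carrier_mat n n" "(1\<^sub>m n + Q) * S = 1\<^sub>m n" "S * (1\<^sub>m n + Q) = 1\<^sub>m n"
  using mat_inverse_exists[OF IQ(2) invertible_mat_det_nonzero[OF IQ(2) inv_plus]]
  by (auto simp: S_def)

lemma dim_Q: "dim_row Q = n" "dim_col Q = n"
  using Q by auto

lemma A_eq: "A = (1\<^sub>m n + Q) * P"
  by (simp add: ave_mat_def P_def dim_Q)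

lemma b_eq: "b = (-2) \<cdot>\<^sub>v (P *\<^sub>v q)"
  by (simp add: ave_rhs_def P_def dim_Q)

lemma R_eq: "R = (1\<^sub>m n - Q) * S"
  by (simp add: cayley_def S_def dim_Q)

lemma carriers: "A \<in> carrier_mat n n" "b \<in> carrier_vec n" "R \<in> carrier_mat n n"
  using P S IQ q by (auto simp: A_eq b_eq R_eq)

text \<open>The inverse of I - Q stands on the right in \<open>A\<close>; it can be cancelled from
  the left because I - Q and I + Q commute.\<close>

lemma minus_mult_A: "(1\<^sub>m n - Q) * A = 1\<^sub>m n + Q"
proof -
  have "1\<^sub>m n - Q + (Q - M) = 1\<^sub>m n + Q - (Q + M)" if "M \<in> carrier_mat n n" for M
    using Q that by (intro eq_matI) auto
  then have "(1\<^sub>m n - Q) * (1\<^sub>m n + Q) = (1\<^sub>m n + Q) * (1\<^sub>m n - Q)"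
    using Q by (simp add: add_mult_distrib_mat[of _ n n _ _ n] minus_mult_distrib_mat[of _ n n _ _ n]
        mult_add_distrib_mat[of _ n n _ n] mult_minus_distrib_mat[of _ n n _ n] minus_carrier_mat)
  then have "(1\<^sub>m n - Q) * A = (1\<^sub>m n + Q) * ((1\<^sub>m n - Q) * P)"
    unfolding A_eq by (simp only: assoc_mult_mat[OF IQ P(1), symmetric] assoc_mult_mat[OF IQ(2,1) P(1), symmetric])
  then show ?thesis
    using right_mult_one_mat[OF IQ(2)] by (simp only: P(2))
qed

lemma R_mult_plus: "R * (1\<^sub>m n + Q) = 1\<^sub>m n - Q"
  using assoc_mult_mat[OF IQ(1) S(1) IQ(2)] right_mult_one_mat[OF IQ(1)] by (simp add: R_eq S(3))

lemma RA: "R * A = 1\<^sub>m n"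
  using assoc_mult_mat[OF carriers(3) IQ(2) P(1)] by (simp add: A_eq R_mult_plus P(2))

lemma index_plus_minus:
  assumes x: "x \<in> carrier_vec n" and i: "i < n"
  shows "((1\<^sub>m n + Q) *\<^sub>v x) $ i = x $ i + (Q *\<^sub>v x) $ i"
    and "((1\<^sub>m n - Q) *\<^sub>v x) $ i = x $ i - (Q *\<^sub>v x) $ i"
  using add_mult_distrib_mat_vec[OF one_carrier_mat Q x] minus_mult_distrib_mat_vec[OF one_carrier_mat Q x]
    x i Q by (simp_all del: index_mult_mat_vec)

text \<open>Multiplying by the nonsingular \<open>I - Q\<close> clears the inverses in the absolute value equation.\<close>

lemma generalized_ave_iff:
  assumes x: "x \<in> carrier_vec n" and y: "y \<in> carrier_vec n" and c: "c \<in> carrier_vec n"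
  shows "A *\<^sub>v x - y = P *\<^sub>v c \<longleftrightarrow>
    (\<forall>i<n. x $ i + (Q *\<^sub>v x) $ i - (y $ i - (Q *\<^sub>v y) $ i) = c $ i)" (is "?l \<longleftrightarrow> ?r")
proof -
  let ?M = "1\<^sub>m n - Q"
  have Ax: "A *\<^sub>v x \<in> carrier_vec n"
    using carriers x by auto
  have Pc: "P *\<^sub>v c \<in> carrier_vec n"
    using P c by auto
  have inj: "u = v" if "u \<in> carrier_vec n" "v \<in> carrier_vec n" "?M *\<^sub>v u = ?M *\<^sub>v v" for u v
    using that assoc_mult_mat_vec[OF P(1) IQ(1)] by (metis P(3) one_mult_mat_vec)
  have "?l \<longleftrightarrow> ?M *\<^sub>v (A *\<^sub>v x - y) = ?M *\<^sub>v (P *\<^sub>v c)"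
    using inj[of "A *\<^sub>v x - y" "P *\<^sub>v c"] Ax Pc y by auto
  also have "?M *\<^sub>v (P *\<^sub>v c) = c"
    using assoc_mult_mat_vec[OF IQ(1) P(1) c] c by (simp add: P(2))
  also have "?M *\<^sub>v (A *\<^sub>v x - y) = ?M *\<^sub>v (A *\<^sub>v x) - ?M *\<^sub>v y"
    by (rule mult_minus_distrib_mat_vec[OF IQ(1) Ax y])
  also have "?M *\<^sub>v (A *\<^sub>v x) = (1\<^sub>m n + Q) *\<^sub>v x"
    using assoc_mult_mat_vec[OF IQ(1) carriers(1) x] by (simp add: minus_mult_A)
  also have "((1\<^sub>m n + Q) *\<^sub>v x - ?M *\<^sub>v y = c) \<longleftrightarrow>
      (\<forall>i<n. ((1\<^sub>m n + Q) *\<^sub>v x - ?M *\<^sub>v y) $ i = c $ i)"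
    using c by (auto intro!: eq_vecI simp: dim_Q simp del: index_mult_mat_vec)
  also have "\<dots> \<longleftrightarrow> ?r"
  proof (intro all_cong1 imp_cong refl)
    fix i assume i: "i < n"
    have "dim_vec (?M *\<^sub>v y) = n"
      by (simp add: dim_Q)
    then have "((1\<^sub>m n + Q) *\<^sub>v x - ?M *\<^sub>v y) $ i = ((1\<^sub>m n + Q) *\<^sub>v x) $ i - (?M *\<^sub>v y) $ i"
      using i by (intro index_minus_vec(1)) simp
    then show "(((1\<^sub>m n + Q) *\<^sub>v x - ?M *\<^sub>v y) $ i = c $ i) \<longleftrightarrow>
        (x $ i + (Q *\<^sub>v x) $ i - (y $ i - (Q *\<^sub>v y) $ i) = c $ i)"
      by (simp only: index_plus_minus[OF x i] index_plus_minus[OF y i])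
  qed
  finally show ?thesis .
qed

lemma b_eq': "b = P *\<^sub>v ((-2) \<cdot>\<^sub>v q)"
  unfolding b_eq by (rule mult_mat_vec[OF P(1) q, symmetric])

lemma ave_solution_iff:
  "x \<in> ave_solutions A b \<longleftrightarrow> x \<in> carrier_vec n \<and>
    (\<forall>i<n. x $ i + (Q *\<^sub>v x) $ i - (\<bar>x $ i\<bar> - (Q *\<^sub>v vec_abs x) $ i) = - 2 * q $ i)"
proof (cases "x \<in> carrier_vec n")
  case True
  then have "x \<in> ave_solutions A b \<longleftrightarrow> A *\<^sub>v x - vec_abs x = b"
    using carriers by (auto simp: ave_solutions_def)
  also have "\<dots> \<longleftrightarrow> (\<forall>i<n. x $ i + (Q *\<^sub>v x) $ i - (vec_abs x $ i - (Q *\<^sub>v vec_abs x) $ i) = ((-2) \<cdot>\<^sub>v q) $ i)"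
    unfolding b_eq' using True q by (intro generalized_ave_iff) auto
  also have "\<dots> \<longleftrightarrow> (\<forall>i<n. x $ i + (Q *\<^sub>v x) $ i - (\<bar>x $ i\<bar> - (Q *\<^sub>v vec_abs x) $ i) = - 2 * q $ i)"
    using True q by (auto simp del: index_mult_mat_vec)
  finally show ?thesis
    using True by simp
qed (use carriers in \<open>auto simp: ave_solutions_def\<close>)

text \<open>Complementarity gives \<open>|u - v| = u + v\<close>, so the difference recovers x. With
  \<open>2u = |x| + x\<close> and \<open>2v = |x| - x\<close>, the equation
  \<open>(I + Q) x - (I - Q) |x| = -2q\<close> reads \<open>v = Q u + q\<close>.\<close>

lemma ave_to_lcp_bij: "bij_betw ave_to_lcp (ave_solutions A b) (lcp_solutions Q q)"
proof (rule bij_betw_byWitness[where f' = "\<lambda>(u, v). u - v"])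
  show "\<forall>x\<in>ave_solutions A b. (case ave_to_lcp x of (u, v) \<Rightarrow> u - v) = x"
    by (auto simp: ave_to_lcp_def ave_solution_iff vec_eq_iff field_simps)
next
  have lcpD: "u \<in> carrier_vec n" "v \<in> carrier_vec n" "v = Q *\<^sub>v u + q"
      "\<And>i. i < n \<Longrightarrow> 0 \<le> u $ i \<and> 0 \<le> v $ i \<and> (u $ i = 0 \<or> v $ i = 0)"
    if "(u, v) \<in> lcp_solutions Q q" for u v
  proof -
    show c: "u \<in> carrier_vec n" "v \<in> carrier_vec n" "v = Q *\<^sub>v u + q"
      using that by (auto simp: lcp_solutions_def dim_Q)
    have *: "\<forall>i<dim_vec u. 0 \<le> u $ i" "\<forall>i<dim_vec v. 0 \<le> v $ i" "u \<bullet> v = 0"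
      using that unfolding lcp_solutions_def by blast+
    have dims: "dim_vec u = n" "dim_vec v = n"
      using c(1,2) by auto
    have nn: "0 \<le> u $ i" "0 \<le> v $ i" if "i < n" for i
      using that *(1,2) unfolding dims by blast+
    have "(\<Sum>i<n. u $ i * v $ i) = 0"
      using *(3) by (simp add: scalar_prod_def lessThan_atLeast0 dims)
    then have "u $ i * v $ i = 0" if "i < n" for i
      using nn that by (subst (asm) sum_nonneg_eq_0_iff) auto
    with nn show "0 \<le> u $ i \<and> 0 \<le> v $ i \<and> (u $ i = 0 \<or> v $ i = 0)" if "i < n" for i
      using that by (metis mult_eq_0_iff)
  qed
  have abs: "\<bar>u $ i - v $ i\<bar> = u $ i + v $ i" if "(u, v) \<in> lcp_solutions Q q" "i < n" for u v i
    using lcpD(4)[OF that] by auto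
  show "\<forall>uv\<in>lcp_solutions Q q. ave_to_lcp (case uv of (u, v) \<Rightarrow> u - v) = uv"
  proof (clarify)
    fix u v assume uv: "(u, v) \<in> lcp_solutions Q q"
    then show "ave_to_lcp (u - v) = (u, v)"
      using lcpD(1,2)[OF uv] abs[OF uv] by (auto simp: ave_to_lcp_def vec_eq_iff)
  qed
  have half: "(Q *\<^sub>v ((1/2) \<cdot>\<^sub>v (x + y))) $ i = ((Q *\<^sub>v x) $ i + (Q *\<^sub>v y) $ i) / 2"
    if "x \<in> carrier_vec n" "y \<in> carrier_vec n" "i < n" for x y i
    using mult_mat_vec[OF Q, of "x + y" "1/2"] mult_add_distrib_mat_vec[OF Q that(1,2)] that Q
    by (simp del: index_mult_mat_vec)
  show "ave_to_lcp ` ave_solutions A b \<subseteq> lcp_solutions Q q"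
  proof (clarify)
    fix u v x assume x: "x \<in> ave_solutions A b" and uv: "(u, v) = ave_to_lcp x"
    have c: "x \<in> carrier_vec n" "vec_abs x \<in> carrier_vec n"
      and eq: "\<And>i. i < n \<Longrightarrow> x $ i + (Q *\<^sub>v x) $ i - (\<bar>x $ i\<bar> - (Q *\<^sub>v vec_abs x) $ i) = - 2 * q $ i"
      using x by (auto simp: ave_solution_iff simp del: index_mult_mat_vec)
    have u: "u = (1/2) \<cdot>\<^sub>v (vec_abs x + x)" and v: "v = (1/2) \<cdot>\<^sub>v (vec_abs x - x)"
      using uv by (auto simp: ave_to_lcp_def)
    have "v = Q *\<^sub>v u + q"
      unfolding v
    proof (rule eq_vecI)
      fix i assume "i < dim_vec (Q *\<^sub>v u + q)"
      then have i: "i < n" using q by simp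
      then show "((1/2) \<cdot>\<^sub>v (vec_abs x - x)) $ i = (Q *\<^sub>v u + q) $ i"
        using eq[OF i] half[OF c(2,1) i] q c Q by (simp add: u del: index_mult_mat_vec)
    qed (use q c in simp)
    moreover have "u \<bullet> v = 0"
      using c by (auto simp: scalar_prod_def u v abs_if intro!: sum.neutral)
    moreover have "u \<in> carrier_vec n" "v \<in> carrier_vec n"
        "\<forall>i<dim_vec u. 0 \<le> u $ i" "\<forall>i<dim_vec v. 0 \<le> v $ i"
      using c by (auto simp: u v)
    ultimately show "(u, v) \<in> lcp_solutions Q q"
      unfolding lcp_solutions_def dim_Q by blast
  qed
  show "(\<lambda>(u, v). u - v) ` lcp_solutions Q q \<subseteq> ave_solutions A b"
  proof (clarify)
    fix u v assume uv: "(u, v) \<in> lcp_solutions Q q"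
    note c = lcpD(1,2)[OF uv]
    have "vec_abs (u - v) = u + v"
      using c abs[OF uv] by (auto simp: vec_eq_iff)
    moreover have "v $ i = (Q *\<^sub>v u) $ i + q $ i" if "i < n" for i
      using arg_cong[OF lcpD(3)[OF uv], of "\<lambda>y. y $ i"] that q by (simp del: index_mult_mat_vec)
    ultimately show "u - v \<in> ave_solutions A b"
      using c Q abs[OF uv] mult_add_distrib_mat_vec[OF Q c] mult_minus_distrib_mat_vec[OF Q c]
      by (auto simp: ave_solution_iff simp del: index_mult_mat_vec)
  qed
qed

end

section \<open>Complexity bounds\<close>

lemma fact_mult_power_le:
  fixes L :: real
  assumes "0 \<le> L"
  shows "fact n * L ^ n \<le> (real n * L) ^ n"
proof -
  have "(fact n :: real) \<le> real n ^ n"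
    using fact_le_power[of n, where ?'a = real] by simp
  then show ?thesis
    using assms by (simp add: power_mult_distrib mult_right_mono)
qed

context rational_lcp
begin

text \<open>The Cramer bound n! L^n, times a further L for the quotient of denominators by which the
  point is scaled to obtain integer data.\<close>

definition K :: real
  where "K = L * (fact n * real_of_int L ^ n)"

abbreviation G :: real
  where "G \<equiv> real n * real_of_int L"

lemma K_ge: "1 \<le> K"
proof -
  have L: "1 \<le> real_of_int L"
    using entry_bounds(1) by simp
  then have "1 \<le> fact n * real_of_int L ^ n"
    using mult_mono[of 1 "fact n :: real" 1 "real_of_int L ^ n"] by simp
  then show ?thesis
    using L mult_mono[of 1 "real_of_int L" 1 "fact n * real_of_int L ^ n"] by (simp add: K_def)
qed

lemma n_le_G: "real n \<le> G" and L_le_G: "real_of_int L \<le> G"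
  using entry_bounds(1) n_pos by (auto simp: mult_le_cancel_left1 mult_le_cancel_right1)

lemma K_le: "K \<le> G ^ (2 * n)"
proof -
  have L: "1 \<le> real_of_int L"
    using entry_bounds(1) by simp
  have G: "1 \<le> G"
    using n_pos L L_le_G by linarith
  have "G ^ 1 \<le> G ^ n"
    using n_pos G by (intro power_increasing) auto
  then have "real_of_int L \<le> G ^ n"
    using L_le_G by simp
  moreover have "fact n * real_of_int L ^ n \<le> G ^ n"
    using L by (intro fact_mult_power_le) simp
  ultimately have "K \<le> G ^ n * G ^ n"
    unfolding K_def using L by (intro mult_mono) auto
  then show ?thesis
    by (simp add: mult_2 power_add)
qed

text \<open>Column \<open>j\<close> of \<open>(I + Q) - (I - Q) Z\<close> is \<open>2 Q e\<^sub>j\<close> or \<open>2 e\<^sub>j\<close> according to the sign of \<open>z\<^sub>j\<close>.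
  Hence the point of \<open>z\<close> solves, up to the factor \<open>d_Q / d_q\<close>, an integer system with entries at most
  \<open>L\<close>, and Cramer's rule applies.\<close>

definition sys :: "real vec \<Rightarrow> int mat"
  where "sys z = mat n n (\<lambda>(i, j). if z $ j = 1 then Qbar $$ (i, j) else if i = j then d_Q else 0)"

text \<open>The factor d_Q / 2 turns the columns 2 Q e_j and 2 e_j into the integer columns of
  \<open>Qbar\<close> and of d_Q times the identity. The bracket is the left side of
  \<open>generalized_ave_iff\<close> with \<open>Z y\<close> in the place of
  \<open>y\<close>.\<close>

lemma sys_mult_vec:
  assumes z: "z \<in> sign_vecs n" and y: "y \<in> carrier_vec n" and i: "i < n"
  shows "(map_mat real_of_int (sys z) *\<^sub>v y) $ i = real_of_int d_Q / 2 *
    (y $ i + (Q *\<^sub>v y) $ i - ((diag_of z *\<^sub>v y) $ i - (Q *\<^sub>v (diag_of z *\<^sub>v y)) $ i))"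
proof -
  note zc = sign_vecsD(1)[OF z]
  have Zy: "diag_of z *\<^sub>v y \<in> carrier_vec n"
    using diag_of_carrier[OF zc] y by simp
  have Qv: "(Q *\<^sub>v v) $ i = (\<Sum>j<n. real_of_int (Qbar $$ (i, j)) / d_Q * v $ j)" if "v \<in> carrier_vec n" for v
    using that Qbar i by (simp add: Q_def scalar_prod_def lessThan_atLeast0)
  have "real_of_int d_Q / 2 *
      (y $ i + (Q *\<^sub>v y) $ i - ((diag_of z *\<^sub>v y) $ i - (Q *\<^sub>v (diag_of z *\<^sub>v y)) $ i))
    = real_of_int d_Q / 2 * ((\<Sum>j<n. if i = j then (1 - z $ j) * y $ j else 0)
        + (\<Sum>j<n. real_of_int (Qbar $$ (i, j)) / d_Q * y $ j)
        + (\<Sum>j<n. real_of_int (Qbar $$ (i, j)) / d_Q * (z $ j * y $ j)))"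
    using i by (simp add: Qv[OF y] Qv[OF Zy] index_diag_of_mult_vec[OF zc y] algebra_simps del: index_mult_mat_vec)
  also have "\<dots> = (\<Sum>j<n. real_of_int d_Q / 2 * ((if i = j then (1 - z $ j) * y $ j else 0)
        + real_of_int (Qbar $$ (i, j)) / d_Q * y $ j
        + real_of_int (Qbar $$ (i, j)) / d_Q * (z $ j * y $ j)))"
    by (simp only: sum.distrib[symmetric] sum_distrib_left)
  also have "\<dots> = (\<Sum>j<n. real_of_int (sys z $$ (i, j)) * y $ j)"
  proof (rule sum.cong)
    fix j assume "j \<in> {..<n}"
    then have j: "j < n" and "z $ j = 1 \<or> z $ j = -1"
      using z by (auto simp: sign_vecs_def)
    then show "real_of_int d_Q / 2 * ((if i = j then (1 - z $ j) * y $ j else 0)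
        + real_of_int (Qbar $$ (i, j)) / d_Q * y $ j
        + real_of_int (Qbar $$ (i, j)) / d_Q * (z $ j * y $ j)) = real_of_int (sys z $$ (i, j)) * y $ j"
      using i d_Q by (auto simp: sys_def)
  qed simp
  also have "\<dots> = (map_mat real_of_int (sys z) *\<^sub>v y) $ i"
    using i y by (simp add: sys_def scalar_prod_def lessThan_atLeast0)
  finally show ?thesis by simp
qed

lemma sys_solution_bounds:
  assumes z: "z \<in> sign_vecs n" and x: "x \<in> carrier_vec n"
    and eq: "A *\<^sub>v x - diag_of z *\<^sub>v x = b"
    and inj: "\<And>y. y \<in> carrier_vec n \<Longrightarrow> A *\<^sub>v y - diag_of z *\<^sub>v y = 0\<^sub>v n \<Longrightarrow> y = 0\<^sub>v n"
    and k: "k < n"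
  shows "\<bar>x $ k\<bar> \<le> K" and "x $ k \<noteq> 0 \<Longrightarrow> 1 / K \<le> \<bar>x $ k\<bar>"
proof -
  let ?N = "map_mat real_of_int (sys z)"
  note Z = diag_of_carrier[OF sign_vecsD(1)[OF z]]
  have N: "sys z \<in> carrier_mat n n" by (simp add: sys_def)
  \<comment> \<open>The system sends x to -(d_Q / d_q) \<open>qbar\<close>; scaling x by this
    \<open>c\<close> makes the right-hand side integral. Both denominators lie between 1 and L, so c
    and 1/c are at most L.\<close>
  define c where "c = real_of_int d_q / real_of_int d_Q"
  have c: "0 < c" using d_q d_Q by (simp add: c_def)
  have Nx: "?N *\<^sub>v (c \<cdot>\<^sub>v x) = map_vec real_of_int (- qbar)"
  proof (rule eq_vecI)
    fix i assume "i < dim_vec (map_vec real_of_int (- qbar))"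
    then have i: "i < n" using qbar by simp
    have Zx: "diag_of z *\<^sub>v x \<in> carrier_vec n" and q2: "(-2) \<cdot>\<^sub>v q \<in> carrier_vec n"
      using Z x q by auto
    have "x $ i + (Q *\<^sub>v x) $ i - ((diag_of z *\<^sub>v x) $ i - (Q *\<^sub>v (diag_of z *\<^sub>v x)) $ i) = ((-2) \<cdot>\<^sub>v q) $ i"
      using generalized_ave_iff[OF x Zx q2] eq i unfolding b_eq' by blast
    then have "(?N *\<^sub>v x) $ i = real_of_int d_Q / 2 * ((-2) \<cdot>\<^sub>v q) $ i"
      using sys_mult_vec[OF z x i] by (simp only:)
    also have "\<dots> = - (real_of_int d_Q / real_of_int d_q * real_of_int (qbar $ i))"
      using i qbar by (simp add: q_def)
    finally show "(?N *\<^sub>v (c \<cdot>\<^sub>v x)) $ i = map_vec real_of_int (- qbar) $ i"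
      using mult_mat_vec[of ?N n n x c] N x i qbar d_Q d_q by (simp add: c_def del: index_mult_mat_vec)
  qed (use N qbar in simp)
  \<comment> \<open>A kernel vector of the integer matrix solves the homogeneous equation at z,
    which \<open>inj\<close> excludes.\<close>
  have det: "det ?N \<noteq> 0"
  proof
    assume "det ?N = 0"
    then obtain y where y: "y \<in> carrier_vec n" "y \<noteq> 0\<^sub>v n" "?N *\<^sub>v y = 0\<^sub>v n"
      using det_0_iff_vec_prod_zero[of ?N n] N by auto
    have Zy: "diag_of z *\<^sub>v y \<in> carrier_vec n"
      using Z y by auto
    have "y $ i + (Q *\<^sub>v y) $ i - ((diag_of z *\<^sub>v y) $ i - (Q *\<^sub>v (diag_of z *\<^sub>v y)) $ i) = 0\<^sub>v n $ i"
      if "i < n" for i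
      using sys_mult_vec[OF z y(1) that] that d_Q by (simp add: y(3) del: index_mult_mat_vec)
    then have "A *\<^sub>v y - diag_of z *\<^sub>v y = P *\<^sub>v 0\<^sub>v n"
      using generalized_ave_iff[OF y(1) Zy zero_carrier_vec] by blast
    also have "\<dots> = 0\<^sub>v n"
      using P(1) by auto
    finally have "y = 0\<^sub>v n"
      by (rule inj[OF y(1)])
    with y show False by simp
  qed
  have B: "\<bar>sys z $$ (i, j)\<bar> \<le> L" if "i < n" "j < n" for i j
    using that d_Q entry_bounds(1,2,4) by (auto simp: sys_def)
  have B': "\<bar>(- qbar) $ i\<bar> \<le> L" if "i < n" for i
    using that qbar entry_bounds(5) by simp
  have cx: "c \<cdot>\<^sub>v x \<in> carrier_vec n" "- qbar \<in> carrier_vec n"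
    using x qbar by auto
  note bds = integer_system_bounds[OF N cx(2,1) Nx det B B' k]
  have ck: "\<bar>(c \<cdot>\<^sub>v x) $ k\<bar> = c * \<bar>x $ k\<bar>"
    using x k c by (simp add: abs_mult)
  let ?F = "fact n * real_of_int L ^ n"
  have F: "0 < ?F" using entry_bounds(1) by simp
  have c_le: "c \<le> L" "1 / c \<le> L"
    using entry_bounds(1-3) d_Q d_q mult_mono[of 1 "real_of_int d_Q" "real_of_int d_q" "real_of_int L"]
      mult_mono[of 1 "real_of_int d_q" "real_of_int d_Q" "real_of_int L"]
    by (auto simp: c_def field_simps)
  have "\<bar>x $ k\<bar> = 1 / c * (c * \<bar>x $ k\<bar>)"
    using c by simp
  also have "\<dots> \<le> L * ?F"
    using bds(1) c c_le entry_bounds(1) unfolding ck by - (rule mult_mono, auto)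
  finally show "\<bar>x $ k\<bar> \<le> K" by (simp add: K_def)
  assume "x $ k \<noteq> 0"
  then have "1 \<le> ?F * (c * \<bar>x $ k\<bar>)"
    using bds(2) x k c unfolding ck by simp
  also have "\<dots> \<le> ?F * (L * \<bar>x $ k\<bar>)"
    using F c_le by (intro mult_left_mono mult_right_mono) auto
  finally show "1 / K \<le> \<bar>x $ k\<bar>"
    using K_ge by (simp add: K_def field_simps)
qed

lemma bounds_of_contraction:
  assumes C: "ave_contraction n A R b w r" and W: "\<And>i. i < n \<Longrightarrow> w i \<le> W"
  shows "ave_contraction_bounds n A R b w r (1 / K) K W"
proof -
  interpret C: ave_contraction n A R b w r by (rule C)
  have diff_index: "(A *\<^sub>v y - diag_of z *\<^sub>v y) $ i = (A *\<^sub>v y) $ i - z $ i * y $ i"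
    if "z \<in> sign_vecs n" "y \<in> carrier_vec n" "i < n" for z y i
    using that diag_of_carrier[OF sign_vecsD(1)[OF that(1)]] index_diag_of_mult_vec[OF sign_vecsD(1)[OF that(1)]]
    by (simp del: index_mult_mat_vec)
  have bnd: "\<bar>C.pt z $ i\<bar> \<le> K \<and> (C.pt z $ i \<noteq> 0 \<longrightarrow> 1 / K \<le> \<bar>C.pt z $ i\<bar>)"
    if z: "z \<in> sign_vecs n" and i: "i < n" for z i
  proof -
    note Z = diag_of_carrier[OF sign_vecsD(1)[OF z]]
    have dims: "dim_vec (diag_of z *\<^sub>v y) = n" for y
      using Z by simp
    have "A *\<^sub>v C.pt z - diag_of z *\<^sub>v C.pt z = b"
      using diff_index[OF z C.pt_carrier[OF z]] C.pt_eq[OF z] C.b carrier_matD[OF Z]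
      by (intro eq_vecI) (auto simp: dims simp del: index_minus_vec(1) index_mult_mat_vec)
    moreover have "y = 0\<^sub>v n" if y: "y \<in> carrier_vec n" and eq: "A *\<^sub>v y - diag_of z *\<^sub>v y = 0\<^sub>v n" for y
    proof (rule C.wnorm_le_imp_zero[OF y])
      fix i assume i: "i < n"
      have "(A *\<^sub>v y) $ i = z $ i * y $ i"
        using diff_index[OF z y i] i unfolding eq by simp
      then show "\<bar>(A *\<^sub>v y) $ i\<bar> \<le> \<bar>y $ i\<bar>"
        using sign_vecsD(3)[OF z i] by (simp add: abs_mult del: index_mult_mat_vec)
    qed
    ultimately show ?thesis
      using sys_solution_bounds[OF z C.pt_carrier[OF z] _ _ i] by blast
  qed
  show ?thesis
  proof
    show "0 < 1 / K" "1 / K \<le> K"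
      using K_ge by (auto simp: field_simps intro: order_trans[of 1 K])
  qed (use n_pos W bnd in auto)
qed

text \<open>Absorbing constants into ln G requires ln G to stay away from 0. Since G is a positive
  integer, only n = L = 1 is critical: there Q is -1, 0 or 1, the values -1 and 1 are excluded by
  nonsingularity, and 0 gives A = 1, whose inverse does not contract.\<close>

lemma G_ge_2:
  assumes C: "ave_contraction n A R b w r"
  shows "2 \<le> G"
proof (rule ccontr)
  interpret C: ave_contraction n A R b w r by (rule C)
  assume "\<not> 2 \<le> G"
  then have "real_of_int (int n * L) < real_of_int 2" by simp
  then have nL: "int n * L < 2" by linarith
  have "int n < 2"
    using nL entry_bounds(1) mult_left_mono[of 1 L "int n"] by simp
  then have n1: "n = 1" using n_pos by simp
  with nL entry_bounds(1) have L1: "L = 1" by simp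
  then have dQ1: "d_Q = 1" and "\<bar>Qbar $$ (0, 0)\<bar> \<le> 1"
    using d_Q entry_bounds(2) entry_bounds(4)[of 0 0] n1 by auto
  then have Q3: "Q $$ (0, 0) \<in> {-1, 0, 1}"
    using Qbar n1 by (auto simp: Q_def)
  have "(1 - Q $$ (0, 0)) * P $$ (0, 0) = 1" "(1 + Q $$ (0, 0)) * S $$ (0, 0) = 1"
    using arg_cong[OF P(2), of "\<lambda>M. M $$ (0, 0)"] arg_cong[OF S(2), of "\<lambda>M. M $$ (0, 0)"] P(1) S(1) Q
    by (auto simp: n1 scalar_prod_def)
  with Q3 have "Q $$ (0, 0) = 0" by auto
  moreover have "(A $$ (0, 0)) = (1 + Q $$ (0, 0)) * P $$ (0, 0)"
    using P(1) Q by (simp add: A_eq n1 scalar_prod_def)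
  ultimately have A1: "A $$ (0, 0) = 1"
    using \<open>(1 - Q $$ (0, 0)) * P $$ (0, 0) = 1\<close> by simp
  \<comment> \<open>With A = 1 the all-ones vector satisfies the hypothesis of the zero
    criterion.\<close>
  have "vec n (\<lambda>_. 1::real) = 0\<^sub>v n"
    using C.A by (intro C.wnorm_le_imp_zero) (auto simp: n1 A1 scalar_prod_def)
  from arg_cong[OF this, of "\<lambda>v. v $ 0"] show False
    by (simp add: n1)
qed

text \<open>Row i of \<open>R (I + Q) = I - Q\<close>, transposed and multiplied by d_Q, is an
  integer system for row i of \<open>R\<close>, with entries at most 2L because d_Q and an entry of
  \<open>Qbar\<close> can meet on the diagonal.\<close>

lemma R_entry_le:
  assumes i: "i < n" and j: "j < n"
  shows "\<bar>R $$ (i, j)\<bar> \<le> fact n * (2 * real_of_int L) ^ n"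
proof -
  define N where "N = (d_Q \<cdot>\<^sub>m 1\<^sub>m n + Qbar)\<^sup>T"
  define c where "c = row (d_Q \<cdot>\<^sub>m 1\<^sub>m n - Qbar) i"
  have N: "N \<in> carrier_mat n n" using Qbar by (simp add: N_def)
  have c: "c \<in> carrier_vec n"
    using row_carrier_vec[of i n "d_Q \<cdot>\<^sub>m 1\<^sub>m n - Qbar" n] i Qbar by (simp add: c_def minus_carrier_mat)
  have rN: "map_mat real_of_int N = real_of_int d_Q \<cdot>\<^sub>m (1\<^sub>m n + Q)\<^sup>T"
    using Qbar d_Q by (intro eq_matI) (auto simp: N_def Q_def field_simps)
  have r: "row R i \<in> carrier_vec n"
    using carriers(3) i by (intro row_carrier_vec) auto
  have eq: "map_mat real_of_int N *\<^sub>v row R i = map_vec real_of_int c"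
  proof (rule eq_vecI)
    fix l assume "l < dim_vec (map_vec real_of_int c)"
    then have l: "l < n" using c by simp
    have "((1\<^sub>m n + Q)\<^sup>T *\<^sub>v row R i) $ l = row R i \<bullet> col (1\<^sub>m n + Q) l"
      using l IQ r by (simp add: dim_Q comm_scalar_prod[OF r, of "col (1\<^sub>m n + Q) l"])
    also have "\<dots> = (R * (1\<^sub>m n + Q)) $$ (i, l)"
      using l i carriers(3) by (simp add: dim_Q)
    also have "\<dots> = (1\<^sub>m n - Q) $$ (i, l)"
      by (simp add: R_mult_plus)
    finally have "(map_mat real_of_int N *\<^sub>v row R i) $ l = d_Q * (1\<^sub>m n - Q) $$ (i, l)"
      unfolding rN using smult_mat_mult_vec[of "(1\<^sub>m n + Q)\<^sup>T" n n "row R i" d_Q] IQ r l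
      by (simp add: dim_Q del: index_mult_mat_vec)
    also have "\<dots> = map_vec real_of_int c $ l"
      using i l Qbar d_Q by (auto simp: c_def Q_def field_simps)
    finally show "(map_mat real_of_int N *\<^sub>v row R i) $ l = map_vec real_of_int c $ l" .
  qed (use N c in simp)
  have det: "det (map_mat real_of_int N) \<noteq> 0"
    unfolding rN using invertible_mat_det_nonzero[OF IQ(2) inv_plus] d_Q
    by (simp add: det_transpose[OF IQ(2)])
  have "\<bar>N $$ (k, l)\<bar> \<le> 2 * L" if "k < n" "l < n" for k l
    using entry_bounds(4)[OF that(2,1)] entry_bounds(1,2) that Qbar d_Q by (auto simp: N_def)
  moreover have "\<bar>c $ l\<bar> \<le> 2 * L" if "l < n" for l
    using entry_bounds(4)[OF i that] entry_bounds(1,2) that i Qbar d_Q by (auto simp: c_def)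
  ultimately have "\<bar>row R i $ j\<bar> \<le> fact n * real_of_int (2 * L) ^ n"
    by (intro integer_system_bounds(1)[OF N c r eq det _ _ j])
  then show ?thesis
    using i j carriers(3) by simp
qed

text \<open>The general \<open>H\<close> stands in for G because \<open>G_ge_2\<close> presupposes a
  contraction, which is yet to be built from this bound. Two powers of H^n cover (2G)^n, and a third
  covers the shift by t.\<close>

lemma R_shift_entry_le:
  assumes G: "2 \<le> H" "G \<le> H" and t: "0 \<le> t" "t \<le> 1" and ij: "i < n" "j < n"
  shows "\<bar>(t \<cdot>\<^sub>m 1\<^sub>m n - (mat_abs R)\<^sup>T) $$ (i, j)\<bar> \<le> H ^ (3 * n)"
proof -
  have "fact n * (2 * real_of_int L) ^ n \<le> (real n * (2 * real_of_int L)) ^ n"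
    using entry_bounds(1) by (intro fact_mult_power_le) simp
  also have "\<dots> = (2 * G) ^ n"
    by (simp add: mult_ac)
  also have "\<dots> \<le> (H * H) ^ n"
    using G entry_bounds(1) by (intro power_mono mult_mono) auto
  also have "\<dots> = H ^ (2 * n)"
    by (simp add: power_mult_distrib mult_2 power_add)
  finally have R: "\<bar>R $$ (j, i)\<bar> \<le> H ^ (2 * n)"
    using R_entry_le[OF ij(2,1)] by linarith
  have "\<bar>(t \<cdot>\<^sub>m 1\<^sub>m n - (mat_abs R)\<^sup>T) $$ (i, j)\<bar> \<le> 1 + \<bar>R $$ (j, i)\<bar>"
    using ij t carriers(3) by auto
  also have "\<dots> \<le> H ^ (2 * n) + H ^ (2 * n)"
    using R G one_le_power[of H "2 * n"] by linarith
  also have "\<dots> = 2 * H ^ (2 * n)"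
    by simp
  also have "\<dots> \<le> H ^ n * H ^ (2 * n)"
    using G n_pos power_increasing[of 1 n H] by (intro mult_right_mono) auto
  also have "\<dots> = H ^ (3 * n)"
    by (simp flip: power_add)
  finally show ?thesis .
qed

text \<open>A weighted column sum condition on \<open>R\<close> is a statement on
  \<open>|R|^T\<close> acting on the weights, and transposition preserves the characteristic
  polynomial and hence the spectral radius.\<close>

lemma contraction_weights:
  assumes G: "2 \<le> H" "G \<le> H" and rho: "real_spectral_radius (mat_abs R) \<le> s"
    and st: "0 \<le> s" "s < t" "t < 1 / 2"
  shows "\<exists>w. ave_contraction n A R b w t \<and> (\<forall>i<n. w i \<le> H ^ (4 * n ^ 2) / (t - s) ^ n)"
proof -
  let ?M = "(mat_abs R)\<^sup>T" and ?c = "map_mat complex_of_real"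
  have M: "?M \<in> carrier_mat n n" "mat_abs R \<in> carrier_mat n n"
    using carriers(3) by auto
  have "spectrum (?c ?M) = spectrum (?c (mat_abs R))"
    using char_poly_transpose_mat[of "?c (mat_abs R)" n] M
      spectrum_root_char_poly[of "?c ?M" n] spectrum_root_char_poly[of "?c (mat_abs R)" n]
    by (simp add: map_mat_transpose)
  then have "real_spectral_radius ?M \<le> s"
    using rho by (simp add: real_spectral_radius_def spectral_radius_def)
  moreover have "t \<le> H ^ (3 * n)"
    using st G one_le_power[of H "3 * n"] by linarith
  moreover have "0 \<le> ?M $$ (i, j)" if "i < n" "j < n" for i j
    using that carriers(3) by simp
  ultimately obtain v where v: "v \<in> carrier_vec n" "\<And>i. i < n \<Longrightarrow> 1 \<le> v $ i"
      "\<And>i. i < n \<Longrightarrow> v $ i * (t - s) ^ n \<le> fact n * (H ^ (3 * n)) ^ n"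
      "\<And>i. i < n \<Longrightarrow> (?M *\<^sub>v v) $ i \<le> t * v $ i"
    using positive_weights_exist[OF M(1) n_pos _ _ st(2) _ _ R_shift_entry_le[OF G]] st by force
  have "(\<Sum>i<n. v $ i * \<bar>R $$ (i, j)\<bar>) \<le> t * v $ j" if "j < n" for j
    using v(4)[OF that] that v(1) carriers(3) by (simp add: scalar_prod_def lessThan_atLeast0 mult.commute)
  then have "ave_contraction n A R b (($) v) t"
    using carriers RA v(2) st by unfold_locales auto
  moreover have "v $ i \<le> H ^ (4 * n ^ 2) / (t - s) ^ n" if "i < n" for i
  proof -
    have "H ^ 1 \<le> H ^ n"
      using G n_pos by (intro power_increasing) auto
    with n_le_G G(2) have "real n \<le> H ^ n"
      unfolding power_one_right by (blast intro: order_trans)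
    \<comment> \<open>The exponent 4 n^2 is n times 3n + n: 3n from the entry bound and n from the
      factor n! <= n^n with n <= H^n.\<close>
    have "fact n * (H ^ (3 * n)) ^ n \<le> (real n * H ^ (3 * n)) ^ n"
      using G by (intro fact_mult_power_le) simp
    also have "\<dots> \<le> (H ^ n * H ^ (3 * n)) ^ n"
      using G \<open>real n \<le> H ^ n\<close> by (intro power_mono mult_right_mono) auto
    also have "\<dots> = H ^ (4 * n ^ 2)"
      by (simp add: power2_eq_square mult.assoc flip: power_add power_mult)
    finally show ?thesis
      using v(3)[OF that] st by (simp add: pos_le_divide_eq)
  qed
  ultimately show ?thesis by blast
qed

lemma unit_weights:
  assumes norm: "norm_one_mat R \<le> t" and t: "0 \<le> t" "t < 1 / 2"
  shows "ave_contraction n A R b (\<lambda>_. 1) t"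
proof
  fix j assume j: "j < n"
  have "(\<Sum>i<n. \<bar>R $$ (i, j)\<bar>) \<le> norm_one_mat R"
    unfolding norm_one_mat_def using carriers(3) j by (intro Max_ge) auto
  then show "(\<Sum>i<n. 1 * \<bar>R $$ (i, j)\<bar>) \<le> t * 1"
    using norm by simp
qed (use carriers RA t in auto)

end

text \<open>4/g belongs to 1/rate = 4n/g. The divisions by ln 2 convert constants into multiples of
  ln G. The 9 collects 1 from ln n, 4 from the weights and 4 from 2 ln K; \<open>l\<close> is the
  logarithmic cost of the slack in the weights.\<close>

definition iteration_const :: "real \<Rightarrow> real \<Rightarrow> real"
  where "iteration_const g l = 4 / g * ((1 + ln (4 / g)) / ln 2 + 9 + l / ln 2)"

lemma iteration_const_nonneg: "0 < g \<Longrightarrow> g < 1 \<Longrightarrow> 0 \<le> l \<Longrightarrow> 0 \<le> iteration_const g l"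
  by (simp add: iteration_const_def)

text \<open>The entries contribute through X/m = K^2 only O(n ln G) to the logarithm, whereas the
  weights may contribute n^2 ln G. The factor n of 1/rate makes this n^3.\<close>

lemma iteration_bound:
  fixes G W K g l :: real and n :: nat
  assumes n: "0 < n" and G: "2 \<le> G" "real n \<le> G" and K: "1 \<le> K" "K \<le> G ^ (2 * n)"
    and W: "1 \<le> W" "ln W \<le> real n ^ 2 * (4 + l / ln 2) * ln G" and g: "0 < g" "g < 1"
  shows "(1 + ln (4 * real n * W * K / (g * (1 / K)))) / (g / (4 * real n))
    \<le> iteration_const g l * real n ^ 3 * ln G"
proof -
  define lG where "lG = ln G"
  have l2: "0 < ln (2::real)" by simp
  have lG: "ln 2 \<le> lG" using G by (simp add: lG_def)
  then have lG0: "0 < lG" using l2 by linarith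
  have n1: "1 \<le> real n" using n by simp
  then have n2: "1 \<le> real n ^ 2" by simp
  have n3: "real n \<le> real n ^ 2"
    using n1 by (simp add: power2_eq_square)
  define p where "p = 4 / g"
  have p: "0 < p" using g by (simp add: p_def)
  have "4 * real n * W * K / (g * (1 / K)) = p * real n * W * K ^ 2"
    using K g by (simp add: field_simps power2_eq_square p_def)
  also have "ln \<dots> = ln p + ln (real n) + ln W + 2 * ln K"
    using K W p n by (simp add: ln_mult_pos ln_realpow)
  finally have "ln (4 * real n * W * K / (g * (1 / K))) = ln (4 / g) + ln (real n) + ln W + 2 * ln K"
    unfolding p_def .
  moreover have "ln (real n) \<le> lG"
    unfolding lG_def using n G by (intro ln_mono) auto
  moreover have "ln K \<le> 2 * real n * lG"
  proof -
    have "ln K \<le> ln (G ^ (2 * n))"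
      using K by (intro ln_mono) auto
    then show ?thesis using G by (simp add: ln_realpow lG_def)
  qed
  ultimately have "1 + ln (4 * real n * W * K / (g * (1 / K)))
      \<le> (1 + ln (4 / g)) + lG + ln W + 4 * real n * lG"
    by linarith
  also have "\<dots> \<le> (1 + ln (4 / g)) / ln 2 * (real n ^ 2 * lG) + 1 * (real n ^ 2 * lG)
      + (4 + l / ln 2) * (real n ^ 2 * lG) + 4 * (real n ^ 2 * lG)"
  proof (intro add_mono)
    have "0 \<le> 1 + ln (4 / g)"
      using g by simp
    moreover have "1 * ln 2 \<le> real n ^ 2 * lG"
      using n2 lG l2 by (intro mult_mono) auto
    ultimately have "(1 + ln (4 / g)) / ln 2 * ln 2 \<le> (1 + ln (4 / g)) / ln 2 * (real n ^ 2 * lG)"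
      by (intro mult_left_mono) auto
    then show "1 + ln (4 / g) \<le> (1 + ln (4 / g)) / ln 2 * (real n ^ 2 * lG)"
      by simp
    show "lG \<le> 1 * (real n ^ 2 * lG)"
      using n2 lG0 by simp
    show "ln W \<le> (4 + l / ln 2) * (real n ^ 2 * lG)"
      using W(2) by (simp add: lG_def mult_ac)
    show "4 * real n * lG \<le> 4 * (real n ^ 2 * lG)"
      using n3 lG0 by simp
  qed
  also have "\<dots> = ((1 + ln (4 / g)) / ln 2 + 9 + l / ln 2) * (real n ^ 2 * lG)"
    by (simp add: algebra_simps)
  finally have "(1 + ln (4 * real n * W * K / (g * (1 / K)))) * (4 * real n / g)
      \<le> ((1 + ln (4 / g)) / ln 2 + 9 + l / ln 2) * (real n ^ 2 * lG) * (4 * real n / g)"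
    using g by (intro mult_right_mono) auto
  also have "\<dots> = iteration_const g l * real n ^ 3 * ln G"
    by (simp add: iteration_const_def lG_def power2_eq_square power3_eq_cube mult_ac)
  finally show ?thesis
    by simp
qed

lemma ln_weight_bound:
  fixes G d :: real and n :: nat
  assumes n: "0 < n" and G: "2 \<le> G" and d: "0 < d" "d \<le> 1"
  shows "1 \<le> G ^ (4 * n ^ 2) / d ^ n"
    and "ln (G ^ (4 * n ^ 2) / d ^ n) \<le> real n ^ 2 * (4 + ln (1 / d) / ln 2) * ln G"
proof -
  have "d ^ n \<le> 1" "1 \<le> G ^ (4 * n ^ 2)"
    using d G by (auto intro: power_le_one)
  then show "1 \<le> G ^ (4 * n ^ 2) / d ^ n"
    using d by (simp add: pos_le_divide_eq)
  have "ln (G ^ (4 * n ^ 2) / d ^ n) = 4 * real n ^ 2 * ln G + real n * ln (1 / d)"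
    using d G by (simp add: ln_div ln_realpow)
  \<comment> \<open>Pads the slack term by n and by ln G / ln 2, both at least 1, to match the shape
    of the leading term.\<close>
  also have "real n * ln (1 / d) \<le> real n ^ 2 * (ln (1 / d) * (ln G / ln 2))"
  proof (intro mult_mono)
    have "1 \<le> ln G / ln 2"
      using G by simp
    then show "ln (1 / d) \<le> ln (1 / d) * (ln G / ln 2)"
      using d mult_left_mono[of 1 "ln G / ln 2" "ln (1 / d)"] by (simp add: ln_div)
  qed (use n d in \<open>auto simp: power2_eq_square ln_div\<close>)
  finally show "ln (G ^ (4 * n ^ 2) / d ^ n) \<le> real n ^ 2 * (4 + ln (1 / d) / ln 2) * ln G"
    by (simp add: algebra_simps)
qed

context rational_lcp
begin

lemma lyap_bound_div_rate_le:
  assumes C: "ave_contraction n A R b w t" and w: "\<And>i. i < n \<Longrightarrow> w i \<le> W"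
    and W: "ln W \<le> real n ^ 2 * (4 + l / ln 2) * ln G"
  shows "ave_contraction_bounds.lyap_bound n t (1 / K) K W / ave_contraction_bounds.rate n t
    \<le> iteration_const (2 / 3 * (1 - 2 * t)) l * real n ^ 3 * ln G"
proof -
  interpret B: ave_contraction_bounds n A R b w t "1 / K" K W
    by (rule bounds_of_contraction[OF C w])
  show ?thesis
    using iteration_bound[OF n_pos G_ge_2[OF C] n_le_G K_ge K_le B.W_ge W B.gain_rate]
    by (simp add: B.lyap_bound_def B.rate_def B.gain_rate_def)
qed

lemma randomized_complexity:
  assumes rho: "real_spectral_radius (mat_abs R) \<le> s" and st: "0 \<le> s" "s < t" "t < 1 / 2"
  shows "\<exists>x. ave_solutions A b = {x} \<and> (\<forall>z \<in> sign_vecs n.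
    lossless_spmf (randomized_sign_flip A b z) \<and>
    fst ` set_spmf (randomized_sign_flip A b z) = {x} \<and>
    randomized_expected_iterations A b z
      \<le> ennreal (iteration_const (2 / 3 * (1 - 2 * t)) (ln (1 / (t - s))) * real n ^ 4 * ln G))"
proof -
  let ?l = "ln (1 / (t - s))" and ?W = "G ^ (4 * n ^ 2) / (t - s) ^ n"
  \<comment> \<open>The maximum with 2 breaks a circle: G >= 2 follows only from a contraction,
    which these weights provide. Afterwards the maximum is G itself.\<close>
  obtain w where C: "ave_contraction n A R b w t"
    and w: "\<And>i. i < n \<Longrightarrow> w i \<le> max 2 G ^ (4 * n ^ 2) / (t - s) ^ n"
    using contraction_weights[OF _ _ rho st, of "max 2 G"] by auto
  have "max 2 G = G"
    using G_ge_2[OF C] by (rule max_absorb2)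
  note w = w[unfolded this]
  interpret B: ave_contraction_bounds n A R b w t "1 / K" K ?W
    by (rule bounds_of_contraction[OF C w])
  have c: "B.lyap_bound / B.rate \<le> iteration_const (2 / 3 * (1 - 2 * t)) ?l * real n ^ 3 * ln G"
    using st by (intro lyap_bound_div_rate_le[OF C w] ln_weight_bound(2)[OF n_pos G_ge_2[OF C]]) auto
  \<comment> \<open>The argument yields the exponent 3; since n >= 1 it is relaxed to the claimed
    4.\<close>
  have n34: "x * real n ^ 3 * ln G \<le> x * real n ^ 4 * ln G" if "0 \<le> x" for x
    using that n_pos G_ge_2[OF C] by (intro mult_right_mono mult_left_mono power_increasing) auto
  have "0 \<le> iteration_const (2 / 3 * (1 - 2 * t)) ?l"
    using st by (intro iteration_const_nonneg) auto
  note c' = order_trans[OF c n34[OF this]]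
  have "ennreal (B.lyap z / B.rate) \<le> ennreal (iteration_const (2 / 3 * (1 - 2 * t)) ?l * real n ^ 4 * ln G)"
    if "z \<in> sign_vecs n" for z
    using B.lyap_le[OF that] B.rate_pos
    by (intro ennreal_leI order_trans[OF divide_right_mono c']) auto
  then show ?thesis
    using B.ave_solutions_eq B.randomized_sign_flip_correct
    by (intro exI[of _ "B.pt B.opt"]) (auto intro: order_trans)
qed

lemma deterministic_complexity:
  assumes norm: "norm_one_mat R \<le> t" and t: "0 \<le> t" "t < 1 / 2" and l: "0 \<le> l"
  shows "\<exists>x. ave_solutions A b = {x} \<and> (\<forall>z \<in> sign_vecs n. \<forall>rule \<in> {gauss_southwell_rule, steepest_rule}.
    sign_flip_terminates rule A b z x (iteration_const (2 / 3 * (1 - 2 * t)) l * real n ^ 3 * ln G))"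
proof -
  note C = unit_weights[OF norm t]
  interpret B: ave_contraction_bounds n A R b "\<lambda>_. 1" t "1 / K" K 1
    by (rule bounds_of_contraction[OF C]) simp
  \<comment> \<open>With unit weights ln W = 0, so any nonnegative \<open>l\<close> is admissible
    and the randomized case's constant can be reused.\<close>
  have "0 \<le> real n ^ 2 * (4 + l / ln 2) * ln G"
    using l G_ge_2[OF C] by simp
  then have "B.lyap_bound / B.rate \<le> iteration_const (2 / 3 * (1 - 2 * t)) l * real n ^ 3 * ln G"
    by (intro lyap_bound_div_rate_le[OF C]) auto
  then show ?thesis
    using B.ave_solutions_eq B.good_rule_terminates B.good_gauss_southwell B.good_steepest by auto
qed

end

theorem corollary5p3:
  fixes rho_bar :: real
  assumes "rho_bar < 1 / 2"
  shows "\<exists>C :: real. \<forall>(n :: nat) (Qbar :: int mat) (qbar :: int vec) (d_Q :: int) (d_q :: int)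
      (Lbar :: int) (Q :: real mat) (q :: real vec) (R :: real mat) (A :: real mat) (b :: real vec).
    n \<ge> 1 \<longrightarrow>
    Qbar \<in> carrier_mat n n \<longrightarrow> qbar \<in> carrier_vec n \<longrightarrow> d_Q > 0 \<longrightarrow> d_q > 0 \<longrightarrow>
    Q = (1 / real_of_int d_Q) \<cdot>\<^sub>m map_mat real_of_int Qbar \<longrightarrow>
    q = (1 / real_of_int d_q) \<cdot>\<^sub>v map_vec real_of_int qbar \<longrightarrow>
    invertible_mat (1\<^sub>m n - Q) \<longrightarrow> invertible_mat (1\<^sub>m n + Q) \<longrightarrow>
    Lbar = Max {d_q, d_Q, norm_inf_vec qbar, norm_max_mat Qbar} \<longrightarrow>
    R = cayley Q \<longrightarrow> A = ave_mat Q \<longrightarrow> b = ave_rhs Q q \<longrightarrow>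
    bij_betw ave_to_lcp (ave_solutions A b) (lcp_solutions Q q) \<and>
    (real_spectral_radius (mat_abs R) \<le> rho_bar \<longrightarrow>
      (\<exists>x. ave_solutions A b = {x} \<and>
        (\<forall>z \<in> sign_vecs n.
          lossless_spmf (randomized_sign_flip A b z) \<and>
          fst ` set_spmf (randomized_sign_flip A b z) = {x} \<and>
          randomized_expected_iterations A b z
            \<le> ennreal (C * real n ^ 4 * ln (real n * real_of_int Lbar))))) \<and>
    (norm_one_mat R \<le> rho_bar \<longrightarrow>
      (\<exists>x. ave_solutions A b = {x} \<and>
        (\<forall>z \<in> sign_vecs n. \<forall>rule \<in> {gauss_southwell_rule, steepest_rule}.
          sign_flip_terminates rule A b z x
            (C * real n ^ 3 * ln (real n * real_of_int Lbar)))))"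
proof -
  \<comment> \<open>The contraction factor must be nonnegative, so a negative \<open>rho_bar\<close>
    is raised to 0. The factor t is then the midpoint of s and 1/2: the slack t - s and the margin 1
    - 2t are positive and depend on \<open>rho_bar\<close> alone.\<close>
  define s where "s = max rho_bar 0"
  define t where "t = (s + 1 / 2) / 2"
  have st: "0 \<le> s" "s < t" "t < 1 / 2" "rho_bar \<le> s" "rho_bar \<le> t"
    using assms by (auto simp: s_def t_def max_def)
  define C where "C = iteration_const (2 / 3 * (1 - 2 * t)) (ln (1 / (t - s)))"
  have l: "0 \<le> ln (1 / (t - s))"
    using st by (intro ln_ge_zero) simp
  show ?thesis
  proof (intro exI[of _ C] allI impI)
    fix n :: nat and Qbar :: "int mat" and qbar :: "int vec" and d_Q d_q Lbar :: int
      and Q :: "real mat" and q :: "real vec" and R A :: "real mat" and b :: "real vec"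
    assume *: "n \<ge> 1" "Qbar \<in> carrier_mat n n" "qbar \<in> carrier_vec n" "d_Q > 0" "d_q > 0"
      "Q = (1 / real_of_int d_Q) \<cdot>\<^sub>m map_mat real_of_int Qbar"
      "q = (1 / real_of_int d_q) \<cdot>\<^sub>v map_vec real_of_int qbar"
      "invertible_mat (1\<^sub>m n - Q)" "invertible_mat (1\<^sub>m n + Q)"
      "Lbar = Max {d_q, d_Q, norm_inf_vec qbar, norm_max_mat Qbar}"
      and eqs: "R = cayley Q" "A = ave_mat Q" "b = ave_rhs Q q"
    interpret rational_lcp n Qbar qbar d_Q d_q Lbar Q q
      using * by unfold_locales auto
    show "bij_betw ave_to_lcp (ave_solutions A b) (lcp_solutions Q q) \<and>
      (real_spectral_radius (mat_abs R) \<le> rho_bar \<longrightarrow>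
        (\<exists>x. ave_solutions A b = {x} \<and>
          (\<forall>z \<in> sign_vecs n.
            lossless_spmf (randomized_sign_flip A b z) \<and>
            fst ` set_spmf (randomized_sign_flip A b z) = {x} \<and>
            randomized_expected_iterations A b z
              \<le> ennreal (C * real n ^ 4 * ln (real n * real_of_int Lbar))))) \<and>
      (norm_one_mat R \<le> rho_bar \<longrightarrow>
        (\<exists>x. ave_solutions A b = {x} \<and>
          (\<forall>z \<in> sign_vecs n. \<forall>rule \<in> {gauss_southwell_rule, steepest_rule}.
            sign_flip_terminates rule A b z x
              (C * real n ^ 3 * ln (real n * real_of_int Lbar)))))"
      unfolding eqs C_def
    proof (intro conjI impI)
      assume "real_spectral_radius (mat_abs (cayley Q)) \<le> rho_bar"
      with st(4) have "real_spectral_radius (mat_abs (cayley Q)) \<le> s" by linarith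
      from randomized_complexity[OF this st(1-3)] show "\<exists>x. ave_solutions (ave_mat Q) (ave_rhs Q q) = {x} \<and>
          (\<forall>z \<in> sign_vecs n.
            lossless_spmf (randomized_sign_flip (ave_mat Q) (ave_rhs Q q) z) \<and>
            fst ` set_spmf (randomized_sign_flip (ave_mat Q) (ave_rhs Q q) z) = {x} \<and>
            randomized_expected_iterations (ave_mat Q) (ave_rhs Q q) z
              \<le> ennreal (iteration_const (2 / 3 * (1 - 2 * t)) (ln (1 / (t - s))) * real n ^ 4 * ln G))" .
    next
      assume "norm_one_mat (cayley Q) \<le> rho_bar"
      with st have "norm_one_mat (cayley Q) \<le> t" "0 \<le> t" by linarith+
      from deterministic_complexity[OF this st(3) l] show "\<exists>x. ave_solutions (ave_mat Q) (ave_rhs Q q) = {x} \<and>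
          (\<forall>z \<in> sign_vecs n. \<forall>rule \<in> {gauss_southwell_rule, steepest_rule}.
            sign_flip_terminates rule (ave_mat Q) (ave_rhs Q q) z x
              (iteration_const (2 / 3 * (1 - 2 * t)) (ln (1 / (t - s))) * real n ^ 3 * ln G))" .
    qed (rule ave_to_lcp_bij)
  qed
qed

end
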